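(* Let $B(x)=\frac{x}{1+x^2}$, $B_0(x)=x$, $B_j(x)=B(B_{j-1}(x))$ for $j\ge1$, and let \[T(x) = 1 + \sum_{n=0}^\infty \prod_{j=0}^n \frac{B_j(x)}{1+B_j(x)},\] which is the generating function satisfying $T(x) = 1 + \frac{x}{1+x}T\!\left(\frac{x}{1+x^2}\right)$ (the cluster generating function for the consecutive pattern $1423$ described in the context). Then $T(x)$ has an infinite number of poles in the complex plane, and consequently $T(x)$ is not differentiably finite (D-finite).
   Context: For the consecutive pattern $1423$: a $k$-cluster of length $n\ge4$ is a permutation of $\{1,\dots,n\}$ containing precisely $k$ occurrences of $1423$ in consecutive positions, such that every entry lies in at least one occurrence and any two successive occurrences overlap in at least one position. With $s_{n,k}$ the number of such clusters (and the convention $s_{1,0}=1$, $s_{n,k}=0$ otherwise for $n<4$), $t_n=\sum_k(-1)^k s_{n,k}$ and $T(x)=1+\sum_{n\ge1}t_nx^n$. A power series is D-finite if it satisfies a nontrivial linear differential equation with polynomial coefficients. *)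

theory Defs
  imports "HOL-Complex_Analysis.Complex_Analysis" "HOL-Computational_Algebra.Computational_Algebra"
begin

definition Bfun :: "complex \<Rightarrow> complex" where
  "Bfun z = z / (1 + z^2)"

definition Bj :: "nat \<Rightarrow> complex \<Rightarrow> complex" where
  "Bj j = Bfun ^^ j"

definition Tfun :: "complex \<Rightarrow> complex" where
  "Tfun z = 1 + (\<Sum>n. \<Prod>j\<le>n. Bj j z / (1 + Bj j z))"

definition Bfps :: "complex fps" where
  "Bfps = fps_X / (1 + fps_X^2)"

definition Bj_fps :: "nat \<Rightarrow> complex fps" where
  "Bj_fps j = ((\<lambda>f. Bfps oo f) ^^ j) fps_X"

(* the n-th summand prod_{j=0}^n B_j/(1+B_j); it has order >= n+1, so the
   formal sum converges and its m-th coefficient only involves n < m *)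
definition Tterm_fps :: "nat \<Rightarrow> complex fps" where
  "Tterm_fps n = (\<Prod>j\<le>n. Bj_fps j / (1 + Bj_fps j))"

definition T_fps :: "complex fps" where
  "T_fps = Abs_fps (\<lambda>m. (if m = 0 then 1 else 0) + (\<Sum>n<m. fps_nth (Tterm_fps n) m))"

definition dfinite :: "complex fps \<Rightarrow> bool" where
  "dfinite f \<longleftrightarrow> (\<exists>r::nat. \<exists>p :: nat \<Rightarrow> complex poly.
      (\<exists>i\<le>r. p i \<noteq> 0) \<and> (\<Sum>i\<le>r. fps_of_poly (p i) * (fps_deriv ^^ i) f) = 0)"

end

(* In the coordinate w = 1/x the map B is w |-> w + 1/w.

   Poles: T(x) = 1 + x/(1+x) T(B(x)) has a pole at x = -1, since T(-1/2) is nonzero, and this pole is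
   pulled back along an infinite backward orbit of -1 under B.

   D-finiteness: T_fps need not converge, so the poles of Tfun say nothing about it directly and the
   argument is algebraic. Let n be least such that T^(n-1) is a C(x)-combination of the n series
   1, T, ..., T^(n-2), and call y ordinary if its coefficients can be chosen regular at y. All but
   finitely many points are ordinary. Away from 0, 1, -1, i, -i the series T and T o B generate
   the same differential module over the local ring, so y is ordinary iff B(y) is. Infinite
   backward orbits then make -1 and -2 ordinary, hence also -1/2. If n >= 2, the modules at -1
   generated by the derivatives of T and of T o B are both finitely generated and stable under
   differentiation, so the first lies in the second; but T = 1 + x/(1+x) T o B has a pole there. If
   n = 1, T is rational and regular at -1, so T(-1/2) = 0, while the values of T along the forward
   orbit of -1/2 force T(-1/2) to be the nonzero sum of the series Tfun. *)

theory Submission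
  imports Defs
begin

section \<open>Linear combinations over a subring\<close>

definition is_subring :: "'a::comm_ring_1 set \<Rightarrow> bool" where
  "is_subring A \<longleftrightarrow> 1 \<in> A \<and> (\<forall>x\<in>A. \<forall>y\<in>A. x - y \<in> A \<and> x * y \<in> A)"

lemma is_subringD:
  assumes "is_subring A"
  shows "0 \<in> A" "1 \<in> A" "x \<in> A \<Longrightarrow> - x \<in> A"
    "x \<in> A \<Longrightarrow> y \<in> A \<Longrightarrow> x + y \<in> A"
    "x \<in> A \<Longrightarrow> y \<in> A \<Longrightarrow> x - y \<in> A"
    "x \<in> A \<Longrightarrow> y \<in> A \<Longrightarrow> x * y \<in> A"
proof -
  have d: "x - y \<in> A" if "x \<in> A" "y \<in> A" for x y
    using assms that by (auto simp: is_subring_def)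
  show "1 \<in> A" using assms by (simp add: is_subring_def)
  then show z: "0 \<in> A" using d[of 1 1] by simp
  show m: "- x \<in> A" if "x \<in> A" for x using d[OF z that] by simp
  show "x + y \<in> A" if "x \<in> A" "y \<in> A" using d[OF that(1) m[OF that(2)]] by simp
  show "x - y \<in> A" if "x \<in> A" "y \<in> A" using d that .
  show "x * y \<in> A" if "x \<in> A" "y \<in> A" using assms that by (auto simp: is_subring_def)
qed

lemma is_subring_power:
  assumes "is_subring A" "x \<in> A"
  shows "x ^ n \<in> A"
  by (induction n) (use assms is_subringD in auto)

text \<open>Coefficients lie in \<open>A\<close> at every index, also beyond \<open>n\<close>, so
  that they can be handled without side conditions.\<close>

definition lin_span :: "'a::comm_ring_1 set \<Rightarrow> (nat \<Rightarrow> 'a) \<Rightarrow> nat \<Rightarrow> 'a set" where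
  "lin_span A u n = {\<Sum>i<n. c i * u i |c. \<forall>i. c i \<in> A}"

lemma lin_spanE:
  assumes "x \<in> lin_span A u n"
  obtains c where "\<And>i. c i \<in> A" "x = (\<Sum>i<n. c i * u i)"
  using assms unfolding lin_span_def by blast

lemma lin_spanI:
  "(\<And>i. c i \<in> A) \<Longrightarrow> (\<Sum>i<n. c i * u i) \<in> lin_span A u n"
  by (auto simp: lin_span_def)

lemma lin_span_zero: "is_subring A \<Longrightarrow> 0 \<in> lin_span A u n"
  using lin_spanI[of "\<lambda>_. 0" A u n] by (simp add: is_subringD)

lemma lin_span_add:
  assumes A: "is_subring A" and x: "x \<in> lin_span A u n" and y: "y \<in> lin_span A u n"
  shows "x + y \<in> lin_span A u n"
proof -
  obtain c where c: "\<And>i. c i \<in> A" "x = (\<Sum>i<n. c i * u i)" using lin_spanE[OF x] by metis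
  obtain d where d: "\<And>i. d i \<in> A" "y = (\<Sum>i<n. d i * u i)" using lin_spanE[OF y] by metis
  have "x + y = (\<Sum>i<n. (c i + d i) * u i)"
    by (simp add: c(2) d(2) sum.distrib algebra_simps)
  then show ?thesis using lin_spanI[of "\<lambda>i. c i + d i" A] c(1) d(1) A by (simp add: is_subringD)
qed

lemma lin_span_mult:
  assumes A: "is_subring A" and a: "a \<in> A" and x: "x \<in> lin_span A u n"
  shows "a * x \<in> lin_span A u n"
proof -
  obtain c where c: "\<And>i. c i \<in> A" "x = (\<Sum>i<n. c i * u i)" using lin_spanE[OF x] by metis
  have "a * x = (\<Sum>i<n. (a * c i) * u i)"
    by (simp add: c(2) sum_distrib_left algebra_simps)
  then show ?thesis using lin_spanI[of "\<lambda>i. a * c i" A] c(1) a A by (simp add: is_subringD)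
qed

lemma lin_span_diff:
  assumes "is_subring A" "x \<in> lin_span A u n" "y \<in> lin_span A u n"
  shows "x - y \<in> lin_span A u n"
  using lin_span_add[OF assms(1,2) lin_span_mult[OF assms(1) _ assms(3), of "-1"]] assms(1)
  by (simp add: is_subringD)

lemma lin_span_sum:
  assumes "is_subring A" "\<And>i. i \<in> I \<Longrightarrow> f i \<in> lin_span A u n"
  shows "(\<Sum>i\<in>I. f i) \<in> lin_span A u n"
  using assms(2) by (induction I rule: infinite_finite_induct)
    (auto simp: lin_span_zero[OF assms(1)] intro: lin_span_add[OF assms(1)])

lemma lin_span_base:
  assumes "is_subring A" "i < n"
  shows "u i \<in> lin_span A u n"
proof -
  have "u i = (\<Sum>j<n. (if j = i then 1 else 0) * u j)"
    using assms(2) by (simp add: if_distrib if_distribR cong: if_cong)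
  then show ?thesis
    using lin_spanI[of "\<lambda>j. if j = i then 1 else 0" A u n] assms(1) by (simp add: is_subringD)
qed

lemma lin_span_subset:
  assumes "is_subring A" "\<And>i. i < n \<Longrightarrow> u i \<in> lin_span A v m"
  shows "lin_span A u n \<subseteq> lin_span A v m"
  using assms by (auto elim!: lin_spanE intro!: lin_span_sum lin_span_mult)

lemma lin_span_mono:
  assumes "is_subring A" "n \<le> m"
  shows "lin_span A u n \<subseteq> lin_span A u m"
  using assms by (intro lin_span_subset) (auto intro: lin_span_base)

text \<open>Over a field \<open>K\<close> the hypothesis \<open>ind\<close> is linear independence of \<open>u 0, \<dots>, u (n - 1)\<close>.\<close>

lemma lin_span_unique:
  fixes u :: "nat \<Rightarrow> 'a::field"
  assumes K: "is_subring K" and inv: "\<And>x. x \<in> K \<Longrightarrow> inverse x \<in> K"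
    and ind: "\<And>k. k < n \<Longrightarrow> u k \<notin> lin_span K u k"
    and c: "\<And>i. c i \<in> K" and d: "\<And>i. d i \<in> K"
    and eq: "(\<Sum>i<n. c i * u i) = (\<Sum>i<n. d i * u i)"
  shows "\<forall>i<n. c i = d i"
  using ind eq
proof (induction n)
  case (Suc n)
  define e where "e = c n - d n"
  have eK: "e \<in> K" using c d K by (simp add: e_def is_subringD)
  have *: "e * u n = (\<Sum>i<n. (d i - c i) * u i)"
    using Suc.prems(2) by (simp add: e_def algebra_simps sum_subtractf)
  \<comment> \<open>If the top coefficients differed, dividing by their difference would put
    \<open>u n\<close> into the span of its predecessors.\<close>
  have "e = 0"
  proof (rule ccontr)
    assume e: "e \<noteq> 0"
    have "(\<Sum>i<n. (d i - c i) * u i) \<in> lin_span K u n"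
      using c d K by (intro lin_spanI) (auto simp: is_subringD)
    then have "inverse e * (e * u n) \<in> lin_span K u n"
      unfolding * by (intro lin_span_mult K inv eK)
    then show False using Suc.prems(1)[of n] e by (simp add: field_simps)
  qed
  then show ?case using Suc.IH Suc.prems by (auto simp: e_def less_Suc_eq)
qed simp

section \<open>Rational Laurent series\<close>

abbreviation fls_of_poly :: "complex poly \<Rightarrow> complex fls" where
  "fls_of_poly P \<equiv> fps_to_fls (fps_of_poly P)"

text \<open>The field C(x), embedded in the Laurent series at 0.\<close>

definition rational :: "complex fls set" where
  "rational = {F. \<exists>P Q. Q \<noteq> 0 \<and> F * fls_of_poly Q = fls_of_poly P}"

text \<open>The point y may lie outside every disc of convergence of a series expanded at 0, so the
  value is read off a fraction whose denominator does not vanish at y.\<close>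

definition rat_val :: "complex fls \<Rightarrow> complex \<Rightarrow> complex \<Rightarrow> bool" where
  "rat_val F y c \<longleftrightarrow>
     (\<exists>P Q. poly Q y \<noteq> 0 \<and> poly P y = c * poly Q y \<and> F * fls_of_poly Q = fls_of_poly P)"

text \<open>The localisation of C[x] at the prime x - y.\<close>

definition regular_at :: "complex \<Rightarrow> complex fls set" where
  "regular_at y = {F. \<exists>c. rat_val F y c}"

lemma fls_of_poly_hom:
  "fls_of_poly (P + Q) = fls_of_poly P + fls_of_poly Q"
  "fls_of_poly (P - Q) = fls_of_poly P - fls_of_poly Q"
  "fls_of_poly (P * Q) = fls_of_poly P * fls_of_poly Q"
  "fls_of_poly (pderiv P) = fls_deriv (fls_of_poly P)"
  "fls_of_poly (P ^ n) = fls_of_poly P ^ n"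
  by (simp_all add: fps_of_poly_add fps_of_poly_diff fps_of_poly_mult fls_times_fps_to_fls
      fps_of_poly_pderiv fls_deriv_fps_to_fls fps_of_poly_power fps_to_fls_power)

lemma fls_of_poly_eq_iff: "fls_of_poly P = fls_of_poly Q \<longleftrightarrow> P = Q"
  by (simp add: fps_of_poly_eq_iff)

lemma rat_val_unique:
  assumes "rat_val F y c" "rat_val F y d"
  shows "c = d"
proof -
  obtain P Q where 1: "poly Q y \<noteq> 0" "poly P y = c * poly Q y" "F * fls_of_poly Q = fls_of_poly P"
    using assms(1) by (auto simp: rat_val_def)
  obtain P' Q' where 2: "poly Q' y \<noteq> 0" "poly P' y = d * poly Q' y" "F * fls_of_poly Q' = fls_of_poly P'"
    using assms(2) by (auto simp: rat_val_def)
  have "fls_of_poly (P * Q') = fls_of_poly (P' * Q)"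
    by (simp add: fls_of_poly_hom 1(3)[symmetric] 2(3)[symmetric])
  then have "P * Q' = P' * Q" by (simp only: fls_of_poly_eq_iff)
  then have "poly P y * poly Q' y = poly P' y * poly Q y" by (metis poly_mult)
  then show ?thesis using 1 2 by simp
qed

lemma rat_val_poly: "rat_val (fls_of_poly P) y (poly P y)"
  unfolding rat_val_def by (intro exI[of _ P] exI[of _ 1]) simp

lemma rat_val_const: "rat_val (fls_const c) y c"
  using rat_val_poly[of "[:c:]" y] by (simp add: fps_of_poly_const)

lemma rat_val_1: "rat_val 1 y 1"
  using rat_val_const[of 1 y] by simp

lemma rat_val_X: "rat_val fls_X y y"
  using rat_val_poly[of "[:0, 1:]" y] by simp

lemma rat_val_diff:
  assumes "rat_val F y c" "rat_val G y d"
  shows "rat_val (F - G) y (c - d)"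
proof -
  obtain P Q where 1: "poly Q y \<noteq> 0" "poly P y = c * poly Q y" "F * fls_of_poly Q = fls_of_poly P"
    using assms(1) by (auto simp: rat_val_def)
  obtain P' Q' where 2: "poly Q' y \<noteq> 0" "poly P' y = d * poly Q' y" "G * fls_of_poly Q' = fls_of_poly P'"
    using assms(2) by (auto simp: rat_val_def)
  have "(F - G) * fls_of_poly (Q * Q') = fls_of_poly (P * Q' - P' * Q)"
    by (simp add: fls_of_poly_hom 1(3)[symmetric] 2(3)[symmetric] algebra_simps)
  moreover have "poly (P * Q' - P' * Q) y = (c - d) * poly (Q * Q') y"
    by (simp add: 1 2 algebra_simps)
  ultimately show ?thesis unfolding rat_val_def using 1(1) 2(1) by (metis mult_eq_0_iff poly_mult)
qed

lemma rat_val_mult: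
  assumes "rat_val F y c" "rat_val G y d"
  shows "rat_val (F * G) y (c * d)"
proof -
  obtain P Q where 1: "poly Q y \<noteq> 0" "poly P y = c * poly Q y" "F * fls_of_poly Q = fls_of_poly P"
    using assms(1) by (auto simp: rat_val_def)
  obtain P' Q' where 2: "poly Q' y \<noteq> 0" "poly P' y = d * poly Q' y" "G * fls_of_poly Q' = fls_of_poly P'"
    using assms(2) by (auto simp: rat_val_def)
  have "(F * G) * fls_of_poly (Q * Q') = fls_of_poly (P * P')"
    by (simp add: fls_of_poly_hom 1(3)[symmetric] 2(3)[symmetric] algebra_simps)
  moreover have "poly (P * P') y = (c * d) * poly (Q * Q') y"
    by (simp add: 1 2 algebra_simps)
  ultimately show ?thesis unfolding rat_val_def using 1(1) 2(1) by (metis mult_eq_0_iff poly_mult)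
qed

lemma rat_val_add:
  assumes "rat_val F y c" "rat_val G y d"
  shows "rat_val (F + G) y (c + d)"
  using rat_val_diff[OF assms(1) rat_val_diff[OF rat_val_const[of 0] assms(2)]] by simp

lemma rat_val_inverse:
  assumes "rat_val F y c" "c \<noteq> 0"
  shows "rat_val (inverse F) y (inverse c)"
proof -
  obtain P Q where 1: "poly Q y \<noteq> 0" "poly P y = c * poly Q y" "F * fls_of_poly Q = fls_of_poly P"
    using assms(1) by (auto simp: rat_val_def)
  have P: "poly P y \<noteq> 0" using 1 assms(2) by simp
  then have "fls_of_poly P \<noteq> 0" by auto
  then have "F \<noteq> 0" using 1(3) by auto
  then have "inverse F * fls_of_poly P = fls_of_poly Q"
    by (simp add: 1(3)[symmetric])
  moreover have "poly Q y = inverse c * poly P y"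
    using 1 assms(2) by simp
  ultimately show ?thesis unfolding rat_val_def using P by blast
qed

lemma rat_val_divide:
  "rat_val F y c \<Longrightarrow> rat_val G y d \<Longrightarrow> d \<noteq> 0 \<Longrightarrow> rat_val (F / G) y (c / d)"
  using rat_val_mult[OF _ rat_val_inverse] by (simp add: divide_inverse)

lemma rat_val_power: "rat_val F y c \<Longrightarrow> rat_val (F ^ n) y (c ^ n)"
  by (induction n) (auto intro: rat_val_mult rat_val_1)

lemma regular_atI: "rat_val F y c \<Longrightarrow> F \<in> regular_at y"
  by (auto simp: regular_at_def)

lemma rat_val_fraction:
  "poly Q y \<noteq> 0 \<Longrightarrow> F * fls_of_poly Q = fls_of_poly P \<Longrightarrow> rat_val F y (poly P y / poly Q y)"
  unfolding rat_val_def by (intro exI[of _ P] exI[of _ Q]) simp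

lemma regular_at_fraction:
  "poly Q y \<noteq> 0 \<Longrightarrow> F * fls_of_poly Q = fls_of_poly P \<Longrightarrow> F \<in> regular_at y"
  by (rule regular_atI[OF rat_val_fraction])

section \<open>The local rings and the field of rational functions\<close>

lemma is_subring_regular_at: "is_subring (regular_at y)"
  unfolding is_subring_def regular_at_def
  by (auto intro: rat_val_1 rat_val_diff rat_val_mult)

lemma is_subring_rational: "is_subring rational"
proof -
  have one: "1 \<in> rational"
    unfolding rational_def by (auto intro!: exI[of _ 1])
  have "F - G \<in> rational \<and> F * G \<in> rational" if FG: "F \<in> rational" "G \<in> rational" for F G
  proof -
    obtain P Q where 1: "Q \<noteq> 0" "F * fls_of_poly Q = fls_of_poly P"
      using FG by (auto simp: rational_def)
    obtain P' Q' where 2: "Q' \<noteq> 0" "G * fls_of_poly Q' = fls_of_poly P'"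
      using FG by (auto simp: rational_def)
    have "(F - G) * fls_of_poly (Q * Q') = fls_of_poly (P * Q' - P' * Q)"
      "(F * G) * fls_of_poly (Q * Q') = fls_of_poly (P * P')"
      by (simp_all add: fls_of_poly_hom 1(2)[symmetric] 2(2)[symmetric] algebra_simps)
    moreover have "Q * Q' \<noteq> 0" using 1 2 by simp
    ultimately show ?thesis unfolding rational_def by blast
  qed
  then show ?thesis using one by (auto simp: is_subring_def)
qed

lemma rational_inverse: "F \<in> rational \<Longrightarrow> inverse F \<in> rational"
proof (cases "F = 0")
  case True
  then show ?thesis using is_subringD(1)[OF is_subring_rational] by simp
next
  case False
  assume "F \<in> rational"
  then obtain P Q where 1: "Q \<noteq> 0" "F * fls_of_poly Q = fls_of_poly P"
    by (auto simp: rational_def)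
  then have "inverse F * fls_of_poly P = fls_of_poly Q"
    using False by (simp add: 1(2)[symmetric])
  moreover have "P \<noteq> 0" using 1 False by (auto simp: fps_of_poly_eq_iff)
  ultimately show ?thesis unfolding rational_def by blast
qed

lemma regular_at_subset_rational: "regular_at y \<subseteq> rational"
proof
  fix F assume "F \<in> regular_at y"
  then obtain P Q where "poly Q y \<noteq> 0" "F * fls_of_poly Q = fls_of_poly P"
    by (auto simp: regular_at_def rat_val_def)
  then show "F \<in> rational" unfolding rational_def by (intro CollectI exI[of _ P] exI[of _ Q]) auto
qed

lemma fls_of_poly_rational: "fls_of_poly P \<in> rational"
  using regular_at_subset_rational regular_atI[OF rat_val_poly] by blast

lemma regular_at_deriv:
  assumes "F \<in> regular_at y"
  shows "fls_deriv F \<in> regular_at y"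
proof -
  obtain P Q where 1: "poly Q y \<noteq> 0" "F * fls_of_poly Q = fls_of_poly P"
    using assms by (auto simp: rat_val_def regular_at_def)
  have "fls_deriv (fls_of_poly P) = fls_deriv F * fls_of_poly Q + F * fls_deriv (fls_of_poly Q)"
    by (simp add: 1(2)[symmetric])
  then have "fls_deriv F * fls_of_poly (Q * Q) = fls_of_poly (pderiv P * Q - P * pderiv Q)"
    by (simp add: fls_of_poly_hom 1(2)[symmetric] algebra_simps)
  then show ?thesis using 1(1) by (intro regular_at_fraction[of "Q * Q"]) simp_all
qed

text \<open>A denominator has finitely many roots, so a rational function is regular at some point,
  and the local ring there is stable under differentiation.\<close>

lemma rational_deriv: "F \<in> rational \<Longrightarrow> fls_deriv F \<in> rational"
proof -
  assume "F \<in> rational"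
  then obtain P Q where 1: "Q \<noteq> 0" "F * fls_of_poly Q = fls_of_poly P"
    by (auto simp: rational_def)
  have "finite {y. poly Q y = 0}" using 1(1) by (rule poly_roots_finite)
  then obtain y where "poly Q y \<noteq> 0"
    using infinite_UNIV_char_0 by (metis (mono_tags, lifting) UNIV_eq_I mem_Collect_eq)
  then have "F \<in> regular_at y"
    using 1(2) by (rule regular_at_fraction)
  then show ?thesis using regular_at_deriv regular_at_subset_rational by blast
qed

lemma finite_not_regular_at:
  assumes "F \<in> rational"
  shows "finite {y. F \<notin> regular_at y}"
proof -
  obtain P Q where 1: "Q \<noteq> 0" "F * fls_of_poly Q = fls_of_poly P"
    using assms by (auto simp: rational_def)
  have "F \<in> regular_at y" if "poly Q y \<noteq> 0" for y
    using that 1(2) by (rule regular_at_fraction)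
  then have "{y. F \<notin> regular_at y} \<subseteq> {y. poly Q y = 0}" by auto
  then show ?thesis using poly_roots_finite[OF 1(1)] finite_subset by blast
qed

lemma rational_power_mult_regular:
  assumes "F \<in> rational"
  shows "\<exists>m. (fls_X - fls_const y) ^ m * F \<in> regular_at y"
proof -
  obtain P Q where 1: "Q \<noteq> 0" "F * fls_of_poly Q = fls_of_poly P"
    using assms by (auto simp: rational_def)
  have pi: "fls_of_poly [:-y, 1:] = fls_X - fls_const y"
    by (simp add: fps_of_poly_pCons fls_times_fps_to_fls fps_to_fls_minus)
  \<comment> \<open>Only the part of the denominator that vanishes at y has to be cleared.\<close>
  obtain R where R: "Q = [:-y, 1:] ^ order y Q * R" "\<not> [:-y, 1:] dvd R"
    using order_decomp[OF 1(1)] by blast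
  have "poly R y \<noteq> 0" using R(2) poly_eq_0_iff_dvd by blast
  moreover have "((fls_X - fls_const y) ^ order y Q * F) * fls_of_poly R = fls_of_poly P"
    unfolding 1(2)[symmetric] by (subst (2) R(1)) (simp only: fls_of_poly_hom pi mult_ac)
  ultimately have "(fls_X - fls_const y) ^ order y Q * F \<in> regular_at y"
    by (rule regular_at_fraction)
  then show ?thesis ..
qed

text \<open>A denominator of least degree has no root in common with its numerator, since the linear
  factor could be cancelled. In this form every root of Q is a genuine pole.\<close>

lemma rational_reduced:
  assumes "F \<in> rational"
  obtains P Q where "Q \<noteq> 0" "F * fls_of_poly Q = fls_of_poly P"
    "\<And>y. poly Q y = 0 \<Longrightarrow> poly P y \<noteq> 0"
proof -
  define S where "S = {Q. Q \<noteq> 0 \<and> (\<exists>P. F * fls_of_poly Q = fls_of_poly P)}"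
  have "S \<noteq> {}" using assms by (auto simp: S_def rational_def)
  then obtain Q where Q: "Q \<in> S" "\<And>R. R \<in> S \<Longrightarrow> degree Q \<le> degree R"
    using ex_has_least_nat[of "\<lambda>Q. Q \<in> S" _ degree] by blast
  then obtain P where P: "F * fls_of_poly Q = fls_of_poly P" and Q0: "Q \<noteq> 0"
    by (auto simp: S_def)
  have "poly P y \<noteq> 0" if y: "poly Q y = 0" for y
  proof
    assume "poly P y = 0"
    then obtain P' where P': "P = P' * [:-y, 1:]" by (metis poly_eq_0_iff_dvd dvd_def mult.commute)
    obtain Q' where Q': "Q = Q' * [:-y, 1:]" using y by (metis poly_eq_0_iff_dvd dvd_def mult.commute)
    have nz: "Q' \<noteq> 0" using Q0 Q' by auto
    have "fls_of_poly [:-y, 1:] \<noteq> 0" by (simp add: fps_of_poly_eq_iff flip: fps_of_poly_0)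
    moreover have "(F * fls_of_poly Q') * fls_of_poly [:-y, 1:] = fls_of_poly P' * fls_of_poly [:-y, 1:]"
      using P by (simp only: P' Q' fls_of_poly_hom mult_ac)
    ultimately have "F * fls_of_poly Q' = fls_of_poly P'" by simp
    then have "Q' \<in> S" using nz by (auto simp: S_def)
    then have "degree Q \<le> degree Q'" by (rule Q(2))
    moreover have "degree Q = degree Q' + 1"
      using nz unfolding Q' by (subst degree_mult_eq) auto
    ultimately show False by simp
  qed
  then show ?thesis using that Q0 P by blast
qed

section \<open>The substitution \<open>x \<mapsto> x / (1 + x\<^sup>2)\<close>\<close>

abbreviation Bfls :: "complex fls" where
  "Bfls \<equiv> fps_to_fls Bfps"

abbreviation pullback :: "complex fls \<Rightarrow> complex fls" where
  "pullback F \<equiv> fls_compose_fps F Bfps"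

lemma Bfps_mult: "Bfps * (1 + fps_X\<^sup>2) = fps_X"
proof -
  have "fps_nth (1 + fps_X\<^sup>2 :: complex fps) 0 \<noteq> 0" by simp
  then have "inverse (1 + fps_X\<^sup>2 :: complex fps) * (1 + fps_X\<^sup>2) = 1" by (rule inverse_mult_eq_1)
  then show ?thesis unfolding Bfps_def by (simp add: fps_divide_unit mult.assoc)
qed

lemma Bfps_nth_0 [simp]: "fps_nth Bfps 0 = 0"
  using arg_cong[OF Bfps_mult, of "\<lambda>f. fps_nth f 0"] by simp

lemma Bfps_nonzero [simp]: "Bfps \<noteq> 0"
  using Bfps_mult by auto

lemma Bfls_eq: "Bfls = fls_X / (1 + fls_X\<^sup>2)"
proof -
  have "Bfls * fps_to_fls (1 + fps_X\<^sup>2) = fls_X"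
    by (subst fls_times_fps_to_fls[symmetric]) (simp add: Bfps_mult)
  then have *: "Bfls * (1 + fls_X\<^sup>2) = fls_X"
    by (simp add: fps_to_fls_power)
  then have "1 + fls_X\<^sup>2 \<noteq> (0 :: complex fls)" by force
  then show ?thesis using * by (simp add: nonzero_eq_divide_eq)
qed

lemma rat_val_Bfls: "1 + y\<^sup>2 \<noteq> 0 \<Longrightarrow> rat_val Bfls y (Bfun y)"
  unfolding Bfls_eq Bfun_def by (intro rat_val_divide rat_val_add rat_val_1 rat_val_power rat_val_X)

lemma rat_val_deriv_Bfls:
  assumes "1 + y\<^sup>2 \<noteq> 0"
  shows "rat_val (fls_deriv Bfls) y ((1 - y\<^sup>2) / (1 + y\<^sup>2)\<^sup>2)"
proof -
  have nz: "1 + fls_X\<^sup>2 \<noteq> (0 :: complex fls)"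
    using Bfps_nonzero Bfls_eq by (metis div_by_0 fps_to_fls_eq_0_iff)
  then have *: "Bfls * (1 + fls_X\<^sup>2) = fls_X" by (simp add: Bfls_eq)
  have "fls_deriv (Bfls * (1 + fls_X\<^sup>2)) = 1" unfolding * by simp
  then have "fls_deriv Bfls * (1 + fls_X\<^sup>2) + Bfls * (2 * fls_X) = 1"
    by (simp add: fls_deriv_power power2_eq_square algebra_simps mult_2)
  then have d: "fls_deriv Bfls * (1 + fls_X\<^sup>2) = 1 - Bfls * (2 * fls_X)"
    by (simp add: eq_diff_eq)
  have "fls_deriv Bfls * (1 + fls_X\<^sup>2)\<^sup>2 = (1 - Bfls * (2 * fls_X)) * (1 + fls_X\<^sup>2)"
    unfolding power2_eq_square[of "1 + fls_X\<^sup>2"] mult.assoc[symmetric] d ..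
  also have "\<dots> = 1 + fls_X\<^sup>2 - (2 * fls_X) * (Bfls * (1 + fls_X\<^sup>2))"
    by (simp only: left_diff_distrib mult_1_left mult.assoc mult.left_commute[of Bfls])
  also have "\<dots> = 1 - fls_X\<^sup>2"
    unfolding * by (simp add: power2_eq_square)
  finally have "fls_deriv Bfls * (1 + fls_X\<^sup>2)\<^sup>2 = 1 - fls_X\<^sup>2" .
  then have **: "fls_deriv Bfls = (1 - fls_X\<^sup>2) / (1 + fls_X\<^sup>2)\<^sup>2"
    using nz by (simp add: nonzero_eq_divide_eq)
  show ?thesis unfolding ** using assms
    by (intro rat_val_divide rat_val_diff rat_val_add rat_val_1 rat_val_power rat_val_X) simp
qed

section \<open>Composition with B as a ring homomorphism\<close>

lemma pullback_hom:
  "pullback (F + G) = pullback F + pullback G"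
  "pullback (F * G) = pullback F * pullback G"
  by (simp_all add: fls_compose_fps_add fls_compose_fps_mult)

lemma pullback_sum: "pullback (\<Sum>i\<in>I. f i) = (\<Sum>i\<in>I. pullback (f i))"
  by (induction I rule: infinite_finite_induct) (auto simp: pullback_hom)

lemma rat_val_pullback_poly:
  assumes "1 + y\<^sup>2 \<noteq> 0"
  shows "rat_val (pullback (fls_of_poly P)) y (poly P (Bfun y))"
proof (induction P)
  case 0
  then show ?case using rat_val_const[of 0 y] by simp
next
  case (pCons a P)
  have "fls_of_poly (pCons a P) = fls_const a + fls_of_poly P * fls_X"
    by (simp add: fps_of_poly_pCons fls_times_fps_to_fls)
  then have "pullback (fls_of_poly (pCons a P)) = fls_const a + pullback (fls_of_poly P) * Bfls"
    by (simp add: pullback_hom del: fls_compose_fps_to_fls)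
  moreover have "poly (pCons a P) (Bfun y) = a + poly P (Bfun y) * Bfun y"
    by simp
  ultimately show ?case
    using rat_val_add[OF rat_val_const rat_val_mult[OF pCons.IH rat_val_Bfls[OF assms]], of a]
    by (simp only:)
qed

lemma rat_val_pullback:
  assumes "1 + y\<^sup>2 \<noteq> 0" "rat_val F (Bfun y) c"
  shows "rat_val (pullback F) y c"
proof -
  obtain P Q where 1: "poly Q (Bfun y) \<noteq> 0" "poly P (Bfun y) = c * poly Q (Bfun y)"
    "F * fls_of_poly Q = fls_of_poly P"
    using assms(2) by (auto simp: rat_val_def)
  have "Q \<noteq> 0" using 1(1) by auto
  then have "pullback (fls_of_poly Q) \<noteq> 0"
    by (subst fls_compose_fps_eq_0_iff) (auto simp: fps_of_poly_eq_iff[of Q 0, simplified])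
  moreover have "pullback F * pullback (fls_of_poly Q) = pullback (fls_of_poly P)"
    by (simp only: 1(3)[symmetric] pullback_hom)
  ultimately have "pullback F = pullback (fls_of_poly P) / pullback (fls_of_poly Q)"
    by (simp add: nonzero_eq_divide_eq del: fls_compose_fps_to_fls)
  moreover have "rat_val (pullback (fls_of_poly P) / pullback (fls_of_poly Q)) y
      (poly P (Bfun y) / poly Q (Bfun y))"
    by (intro rat_val_divide rat_val_pullback_poly assms(1) 1(1))
  ultimately show ?thesis using 1(1,2) by simp
qed

lemma pullback_rational:
  assumes "F \<in> rational"
  shows "pullback F \<in> rational"
proof -
  have poly: "pullback (fls_of_poly P) \<in> rational" for P
    using rat_val_pullback_poly[of 0 P] regular_atI regular_at_subset_rational by fastforce
  obtain P Q where 1: "Q \<noteq> 0" "F * fls_of_poly Q = fls_of_poly P"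
    using assms by (auto simp: rational_def)
  have "pullback (fls_of_poly Q) \<noteq> 0"
    using 1(1) by (subst fls_compose_fps_eq_0_iff) (auto simp: fps_of_poly_eq_iff[of Q 0, simplified])
  moreover have "pullback F * pullback (fls_of_poly Q) = pullback (fls_of_poly P)"
    by (simp only: 1(2)[symmetric] pullback_hom)
  ultimately have "pullback F = pullback (fls_of_poly P) * inverse (pullback (fls_of_poly Q))"
    by (simp add: nonzero_eq_divide_eq divide_inverse[symmetric] del: fls_compose_fps_to_fls)
  then show ?thesis
    using is_subringD(6)[OF is_subring_rational poly rational_inverse[OF poly]] by simp
qed

lemma regular_at_pullback:
  "1 + y\<^sup>2 \<noteq> 0 \<Longrightarrow> F \<in> regular_at (Bfun y) \<Longrightarrow> pullback F \<in> regular_at y"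
  unfolding regular_at_def using rat_val_pullback by blast

text \<open>Write F = P / Q in lowest terms. Evaluating the pulled back identity F Q = P at y shows
  that Q(B(y)) = 0 would force P(B(y)) = 0.\<close>

lemma regular_at_of_pullback:
  assumes "1 + y\<^sup>2 \<noteq> 0" "F \<in> rational" "pullback F \<in> regular_at y"
  shows "F \<in> regular_at (Bfun y)"
proof -
  obtain P Q where 1: "F * fls_of_poly Q = fls_of_poly P"
    "poly Q (Bfun y) = 0 \<Longrightarrow> poly P (Bfun y) \<noteq> 0"
    using rational_reduced[OF assms(2)] by metis
  obtain c where c: "rat_val (pullback F) y c" using assms(3) by (auto simp: regular_at_def)
  have "rat_val (pullback (F * fls_of_poly Q)) y (c * poly Q (Bfun y))"
    unfolding pullback_hom by (intro rat_val_mult c rat_val_pullback_poly assms(1))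
  then have "c * poly Q (Bfun y) = poly P (Bfun y)"
    using rat_val_unique rat_val_pullback_poly[OF assms(1)] unfolding 1(1) by blast
  then have "poly Q (Bfun y) \<noteq> 0" using 1(2) by auto
  then show ?thesis using 1(1) by (rule regular_at_fraction)
qed

lemma deriv_pullback_fps:
  "fls_deriv (pullback (fps_to_fls f)) = pullback (fps_to_fls (fps_deriv f)) * fls_deriv Bfls"
  by (simp add: fls_deriv_fps_to_fls fps_compose_deriv fls_times_fps_to_fls)

text \<open>The points where one of (1 + x) / x, x / (1 + x), B' and 1 / B' has a pole: 0 and -1
  from the factor of the functional equation, 1 and -1 as zeros of B', \<i> and -\<i> as poles of
  B.\<close>

definition exceptional :: "complex set" where
  "exceptional = {0, 1, -1, \<i>, -\<i>}"

lemma not_exceptionalD: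
  assumes "y \<notin> exceptional"
  shows "y \<noteq> 0" "1 + y \<noteq> 0" "1 - y\<^sup>2 \<noteq> 0" "1 + y\<^sup>2 \<noteq> 0"
proof -
  show "y \<noteq> 0" "1 + y \<noteq> 0" using assms by (auto simp: exceptional_def add_eq_0_iff)
  have "1 - y\<^sup>2 = - ((y - 1) * (y - -1))" "1 + y\<^sup>2 = (y - \<i>) * (y - -\<i>)"
    by (simp_all add: power2_eq_square algebra_simps)
  then show "1 - y\<^sup>2 \<noteq> 0" "1 + y\<^sup>2 \<noteq> 0"
    using assms unfolding exceptional_def by (simp_all only: right_minus_eq mult_eq_0_iff neg_equal_0_iff_equal insert_iff empty_iff simp_thms)
      blast+
qed

section \<open>The functional equation of the formal series\<close>

lemma fps_nth_compose_cong:
  assumes "fps_nth g 0 = 0" "\<And>i. i \<le> m \<Longrightarrow> fps_nth f i = fps_nth f' i"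
  shows "fps_nth (f oo g) m = fps_nth (f' oo g) m"
  using assms by (simp add: fps_compose_nth)

lemma Bj_fps_nth_0: "fps_nth (Bj_fps j) 0 = 0"
  by (induction j) (simp_all add: Bj_fps_def)

text \<open>The definition adds new copies of B on the outside; associativity moves them inside, as
  the functional equation requires.\<close>

lemma Bj_fps_Suc: "Bj_fps (Suc j) = Bj_fps j oo Bfps"
proof (induction j)
  case (Suc j)
  have step: "Bj_fps (Suc i) = Bfps oo Bj_fps i" for i by (simp add: Bj_fps_def)
  show ?case unfolding step[of "Suc j"] unfolding Suc.IH
    by (subst fps_compose_assoc) (simp_all add: Bj_fps_nth_0 flip: Suc.IH step)
qed (simp add: Bj_fps_def)

text \<open>Split off the factor j = 0; the remaining factors are the previous product composed with
  B.\<close>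

lemma Tterm_fps_Suc:
  "Tterm_fps (Suc n) = fps_X / (1 + fps_X) * (Tterm_fps n oo Bfps)"
proof -
  have div: "(f / (1 + f)) oo Bfps = (f oo Bfps) / (1 + (f oo Bfps))" if "fps_nth f 0 = 0" for f :: "complex fps"
    using that by (subst fps_divide_compose) (auto simp: fps_compose_add_distrib)
  have "Tterm_fps n oo Bfps = (\<Prod>j\<le>n. (Bj_fps j / (1 + Bj_fps j)) oo Bfps)"
    unfolding Tterm_fps_def by (simp add: fps_compose_prod_distrib)
  also have "\<dots> = (\<Prod>j\<le>n. Bj_fps (Suc j) / (1 + Bj_fps (Suc j)))"
    by (simp add: div Bj_fps_nth_0 Bj_fps_Suc)
  finally show ?thesis
    unfolding Tterm_fps_def prod.atMost_Suc_shift by (simp add: Bj_fps_def)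
qed

lemma fps_X_div_nth_0: "fps_nth (fps_X / (1 + fps_X) :: complex fps) 0 = 0"
  by (simp add: fps_divide_unit)

lemma fps_nth_mult_eq_0:
  assumes "\<And>i. i < a \<Longrightarrow> fps_nth f i = 0" "\<And>i. i < b \<Longrightarrow> fps_nth g i = 0" "m < a + b"
  shows "fps_nth (f * g :: 'a::comm_semiring_1 fps) m = 0"
  unfolding fps_mult_nth
proof (intro sum.neutral ballI)
  fix i assume "i \<in> {0..m}"
  then have "i < a \<or> m - i < b" using assms(3) by auto
  then show "fps_nth f i * fps_nth g (m - i) = 0" using assms(1,2) by auto
qed

text \<open>Composition with B, which has no constant term, does not lower the order of vanishing,
  and the factor x / (1 + x) raises it by one.\<close>

lemma Tterm_fps_nth: "m \<le> n \<Longrightarrow> fps_nth (Tterm_fps n) m = 0"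
proof (induction n arbitrary: m)
  case 0
  then show ?case by (simp add: Tterm_fps_def Bj_fps_def fps_X_div_nth_0)
next
  case (Suc n)
  have "fps_nth (Tterm_fps n oo Bfps) i = 0" if "i < Suc n" for i
    using fps_nth_compose_cong[of Bfps i "Tterm_fps n" 0] Suc.IH that by simp
  then show ?case unfolding Tterm_fps_Suc
    using Suc.prems by (intro fps_nth_mult_eq_0[of 1 _ "Suc n"]) (auto simp: fps_X_div_nth_0)
qed

lemma T_fps_nth:
  assumes "m \<le> N"
  shows "fps_nth T_fps m = fps_nth (1 + (\<Sum>n<N. Tterm_fps n)) m"
proof -
  have "(\<Sum>n<m. fps_nth (Tterm_fps n) m) = (\<Sum>n<N. fps_nth (Tterm_fps n) m)"
    using assms by (intro sum.mono_neutral_left) (auto simp: Tterm_fps_nth)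
  then show ?thesis by (simp add: T_fps_def fps_sum_nth)
qed

text \<open>The partial sums satisfy the equation up to a shift of N, and each coefficient of T is
  already that of a partial sum.\<close>

lemma T_fps_functional: "T_fps = 1 + fps_X / (1 + fps_X) * (T_fps oo Bfps)"
proof (rule fps_ext)
  fix m
  define S where "S N = 1 + (\<Sum>n<N. Tterm_fps n)" for N
  have S: "S (Suc N) = 1 + fps_X / (1 + fps_X) * (S N oo Bfps)" for N
  proof -
    have "S N oo Bfps = 1 + (\<Sum>n<N. Tterm_fps n oo Bfps)"
      by (simp add: S_def fps_compose_add_distrib fps_compose_sum_distrib)
    moreover have "Tterm_fps 0 = fps_X / (1 + fps_X)" by (simp add: Tterm_fps_def Bj_fps_def)
    ultimately have "1 + fps_X / (1 + fps_X) * (S N oo Bfps) =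
        1 + (Tterm_fps 0 + (\<Sum>n<N. Tterm_fps (Suc n)))"
      by (simp add: Tterm_fps_Suc distrib_left sum_distrib_left)
    then show ?thesis by (simp add: S_def sum.lessThan_Suc_shift del: sum.lessThan_Suc)
  qed
  have "fps_nth T_fps m = fps_nth (S (Suc m)) m" unfolding S_def by (intro T_fps_nth) simp
  also have "\<dots> = fps_nth (1 + fps_X / (1 + fps_X) * (T_fps oo Bfps)) m"
  proof -
    \<comment> \<open>Coefficients up to m of a composition with B involve only coefficients up to
      m, where \<open>S m\<close> agrees with T.\<close>
    have "fps_nth (S m oo Bfps) i = fps_nth (T_fps oo Bfps) i" if "i \<le> m" for i
      using that by (intro fps_nth_compose_cong) (auto simp: S_def T_fps_nth[of _ m])
    then show ?thesis unfolding S fps_add_nth fps_mult_nth by simp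
  qed
  finally show "fps_nth T_fps m = \<dots>" .
qed

section \<open>Jets of the formal series and ordinary points\<close>

text \<open>The constant 1 comes first because the functional equation is inhomogeneous; the
  derivatives of T follow with their index shifted by one.\<close>

definition jet :: "nat \<Rightarrow> complex fls" where
  "jet i = (case i of 0 \<Rightarrow> 1 | Suc k \<Rightarrow> fps_to_fls ((fps_deriv ^^ k) T_fps))"

definition pjet :: "nat \<Rightarrow> complex fls" where
  "pjet i = pullback (jet i)"

lemma jet_0 [simp]: "jet 0 = 1" and pjet_0 [simp]: "pjet 0 = 1"
  by (simp_all add: jet_def pjet_def)

lemma deriv_jet: "fls_deriv (jet (Suc i)) = jet (Suc (Suc i))"
  by (simp add: jet_def fls_deriv_fps_to_fls)

lemma deriv_pjet: "fls_deriv (pjet (Suc i)) = fls_deriv Bfls * pjet (Suc (Suc i))"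
  using deriv_pullback_fps[of "(fps_deriv ^^ i) T_fps"] by (simp add: jet_def pjet_def mult.commute)

lemma fls_X_nonzero: "fls_X \<noteq> (0 :: complex fls)"
  by simp

lemma jet_functional: "(1 + fls_X) * (jet 1 - 1) = fls_X * pjet 1"
proof -
  have "(1 + fps_X) * (fps_X / (1 + fps_X)) = (fps_X :: complex fps)"
    using inverse_mult_eq_1[of "1 + fps_X :: complex fps"]
    by (simp add: fps_divide_unit mult.left_commute mult.commute)
  then have "(1 + fps_X) * (T_fps - 1) = fps_X * (T_fps oo Bfps)"
    using T_fps_functional by (metis add_diff_cancel_left' mult.assoc)
  then have "fps_to_fls ((1 + fps_X) * (T_fps - 1)) = fps_to_fls (fps_X * (T_fps oo Bfps))"
    by (rule arg_cong)
  then show ?thesis by (simp add: jet_def pjet_def fls_times_fps_to_fls)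
qed

section \<open>Comparison of the differential modules of T and T o B\<close>

definition diff_subring :: "complex fls set \<Rightarrow> bool" where
  "diff_subring A \<longleftrightarrow> is_subring A \<and> (\<forall>x\<in>A. fls_deriv x \<in> A)"

lemma diff_subring_regular_at: "diff_subring (regular_at y)"
  and diff_subring_rational: "diff_subring rational"
  by (simp_all add: diff_subring_def is_subring_regular_at regular_at_deriv
      is_subring_rational rational_deriv)

lemma deriv_lin_span:
  assumes A: "diff_subring A" and f: "f \<in> lin_span A u n" and "n \<le> m"
    and u: "\<And>i. i < n \<Longrightarrow> fls_deriv (u i) \<in> lin_span A u m"
  shows "fls_deriv f \<in> lin_span A u m"
proof -
  have R: "is_subring A" using A by (simp add: diff_subring_def)
  obtain c where c: "\<And>i. c i \<in> A" "f = (\<Sum>i<n. c i * u i)" using f by (metis lin_spanE)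
  have eq: "fls_deriv f = (\<Sum>i<n. c i * fls_deriv (u i) + fls_deriv (c i) * u i)"
    by (simp add: c(2) fls_deriv_sum)
  have mem: "c i * fls_deriv (u i) + fls_deriv (c i) * u i \<in> lin_span A u m" if "i \<in> {..<n}" for i
  proof -
    have i: "i < n" "i < m" using that assms(3) by auto
    have "fls_deriv (c i) \<in> A" using A c(1) by (simp add: diff_subring_def)
    then show ?thesis
      by (rule lin_span_add[OF R lin_span_mult[OF R c(1) u[OF i(1)]]
            lin_span_mult[OF R _ lin_span_base[OF R i(2)]]])
  qed
  show ?thesis unfolding eq by (rule lin_span_sum[OF R mem])
qed

lemma deriv_lin_span_jet:
  assumes "diff_subring A" "f \<in> lin_span A jet n"
  shows "fls_deriv f \<in> lin_span A jet (Suc n)"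
proof (rule deriv_lin_span[OF assms])
  have R: "is_subring A" using assms(1) by (simp add: diff_subring_def)
  show "fls_deriv (jet i) \<in> lin_span A jet (Suc n)" if "i < n" for i
    using that by (cases i) (simp_all add: lin_span_zero[OF R] deriv_jet lin_span_base[OF R])
qed simp

lemma deriv_lin_span_pjet:
  assumes "diff_subring A" "fls_deriv Bfls \<in> A" "f \<in> lin_span A pjet n"
  shows "fls_deriv f \<in> lin_span A pjet (Suc n)"
proof (rule deriv_lin_span[OF assms(1,3)])
  have R: "is_subring A" using assms(1) by (simp add: diff_subring_def)
  show "fls_deriv (pjet i) \<in> lin_span A pjet (Suc n)" if "i < n" for i
    using that
    by (cases i) (simp_all add: lin_span_zero[OF R] deriv_pjet lin_span_mult[OF R assms(2)] lin_span_base[OF R])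
qed simp

text \<open>The functional equation gives T o B = (1 + x) / x (T - 1). By the chain rule each
  further pulled back derivative arises from differentiating the previous one and dividing by
  B'.\<close>

lemma pjet_in_span_jet:
  assumes A: "diff_subring A" and a: "(1 + fls_X) / fls_X \<in> A" and b: "inverse (fls_deriv Bfls) \<in> A"
    and nz: "fls_deriv Bfls \<noteq> 0"
  shows "pjet i \<in> lin_span A jet (Suc i)"
proof (induction i)
  have R: "is_subring A" using A by (simp add: diff_subring_def)
  {
    case 0
    show ?case using lin_span_base[OF R, of 0 "Suc 0" jet] by simp
  next
    case (Suc i)
    show ?case
    proof (cases i)
      case 0
      have "pjet 1 = (1 + fls_X) / fls_X * (jet 1 - 1)"
        by (simp only: times_divide_eq_left jet_functional nonzero_mult_div_cancel_left[OF fls_X_nonzero])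
      moreover have "jet 1 - jet 0 \<in> lin_span A jet 2"
        by (intro lin_span_diff R lin_span_base) simp_all
      ultimately show ?thesis using 0 lin_span_mult[OF R a] by (simp add: numeral_2_eq_2)
    next
      case (Suc k)
      have "pjet (Suc i) = inverse (fls_deriv Bfls) * fls_deriv (pjet i)"
        using nz by (simp add: Suc deriv_pjet)
      then show ?thesis
        using lin_span_mult[OF R b deriv_lin_span_jet[OF A Suc.IH]] by simp
    qed
  }
qed

text \<open>Differentiate T = 1 + x / (1 + x) T o B repeatedly; the chain rule only multiplies by
  B', so nothing is divided by B' here.\<close>

lemma jet_in_span_pjet:
  assumes A: "diff_subring A" and a: "fls_X / (1 + fls_X) \<in> A" and b: "fls_deriv Bfls \<in> A"
  shows "jet i \<in> lin_span A pjet (Suc i)"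
proof (induction i)
  have R: "is_subring A" using A by (simp add: diff_subring_def)
  {
    case 0
    show ?case using lin_span_base[OF R, of 0 "Suc 0" pjet] by simp
  next
    case (Suc i)
    show ?case
    proof (cases i)
      case 0
      have "(1 + fls_X :: complex fls) \<noteq> 0"
        using rat_val_unique[OF rat_val_add[OF rat_val_1 rat_val_X, of 0]] rat_val_const[of 0 0] by force
      then have "jet 1 = pjet 0 + fls_X / (1 + fls_X) * pjet 1"
        using jet_functional by (simp add: field_simps)
      moreover have "pjet 0 + fls_X / (1 + fls_X) * pjet 1 \<in> lin_span A pjet 2"
        by (intro lin_span_add lin_span_mult R a lin_span_base) simp_all
      ultimately show ?thesis using 0 by (simp add: numeral_2_eq_2)
    next
      case (Suc k)
      then have "jet (Suc i) = fls_deriv (jet i)" by (simp add: deriv_jet)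
      then show ?thesis using deriv_lin_span_pjet[OF A b Suc.IH] by simp
    qed
  }
qed

lemma deriv_Bfls_nonzero: "fls_deriv Bfls \<noteq> 0"
proof
  assume "fls_deriv Bfls = 0"
  then show False
    using rat_val_unique[OF rat_val_deriv_Bfls[of 0]] rat_val_const[of 0 0] by force
qed

lemma regular_at_coeffs:
  assumes "y \<notin> exceptional"
  shows "(1 + fls_X) / fls_X \<in> regular_at y" "fls_X / (1 + fls_X) \<in> regular_at y"
    "fls_deriv Bfls \<in> regular_at y" "inverse (fls_deriv Bfls) \<in> regular_at y"
proof -
  note y = not_exceptionalD[OF assms]
  have v: "rat_val (1 + fls_X) y (1 + y)" by (rule rat_val_add[OF rat_val_1 rat_val_X])
  note d = rat_val_deriv_Bfls[OF y(4)]
  have nz: "(1 - y\<^sup>2) / (1 + y\<^sup>2)\<^sup>2 \<noteq> 0" using y by simp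
  show "(1 + fls_X) / fls_X \<in> regular_at y"
    by (rule regular_atI[OF rat_val_divide[OF v rat_val_X y(1)]])
  show "fls_X / (1 + fls_X) \<in> regular_at y"
    by (rule regular_atI[OF rat_val_divide[OF rat_val_X v y(2)]])
  show "fls_deriv Bfls \<in> regular_at y" by (rule regular_atI[OF d])
  show "inverse (fls_deriv Bfls) \<in> regular_at y" by (rule regular_atI[OF rat_val_inverse[OF d nz]])
qed

lemma span_jet_eq_span_pjet:
  assumes "y \<notin> exceptional"
  shows "lin_span (regular_at y) jet n = lin_span (regular_at y) pjet n"
proof
  have R: "is_subring (regular_at y)" by (rule is_subring_regular_at)
  note c = regular_at_coeffs[OF assms]
  show "lin_span (regular_at y) jet n \<subseteq> lin_span (regular_at y) pjet n"
  proof (rule lin_span_subset[OF R])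
    fix i assume "i < n"
    then show "jet i \<in> lin_span (regular_at y) pjet n"
      using jet_in_span_pjet[OF diff_subring_regular_at c(2,3), of i] lin_span_mono[OF R, of "Suc i" n]
      by auto
  qed
  show "lin_span (regular_at y) pjet n \<subseteq> lin_span (regular_at y) jet n"
  proof (rule lin_span_subset[OF R])
    fix i assume "i < n"
    then show "pjet i \<in> lin_span (regular_at y) jet n"
      using pjet_in_span_jet[OF diff_subring_regular_at c(1,4) deriv_Bfls_nonzero, of i]
        lin_span_mono[OF R, of "Suc i" n]
      by auto
  qed
qed

lemma span_jet_eq_span_pjet_rational: "lin_span rational jet n = lin_span rational pjet n"
proof -
  \<comment> \<open>The point 2 is an arbitrary choice: regularity at any point outside the
    exceptional set gives rationality.\<close>
  have "2 \<notin> exceptional" by (auto simp: exceptional_def complex_eq_iff)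
  note c = regular_at_coeffs[OF this, THEN subsetD[OF regular_at_subset_rational]]
  have R: "is_subring rational" by (rule is_subring_rational)
  show ?thesis
  proof
    show "lin_span rational jet n \<subseteq> lin_span rational pjet n"
    proof (rule lin_span_subset[OF R])
      fix i assume "i < n"
      then show "jet i \<in> lin_span rational pjet n"
        using jet_in_span_pjet[OF diff_subring_rational c(2,3), of i] lin_span_mono[OF R, of "Suc i" n]
        by auto
    qed
    show "lin_span rational pjet n \<subseteq> lin_span rational jet n"
    proof (rule lin_span_subset[OF R])
      fix i assume "i < n"
      then show "pjet i \<in> lin_span rational jet n"
        using pjet_in_span_jet[OF diff_subring_rational c(1,4) deriv_Bfls_nonzero, of i]
          lin_span_mono[OF R, of "Suc i" n]
        by auto
    qed
  qed
qed

text \<open>Since \<open>jet 0\<close> is the constant 1, this describes an inhomogeneous linear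
  equation for T of least order n - 1; for n = 1 it says that T is rational.\<close>

definition minimal_order :: "nat \<Rightarrow> bool" where
  "minimal_order n \<longleftrightarrow> jet n \<in> lin_span rational jet n \<and> (\<forall>k<n. jet k \<notin> lin_span rational jet k)"

text \<open>The equation can be made monic with coefficients that have no pole at y.\<close>

definition ordinary :: "nat \<Rightarrow> complex \<Rightarrow> bool" where
  "ordinary n y \<longleftrightarrow> jet n \<in> lin_span (regular_at y) jet n"

lemma fps_to_fls_sum: "fps_to_fls (\<Sum>i\<in>I. f i) = (\<Sum>i\<in>I. fps_to_fls (f i))"
  by (induction I rule: infinite_finite_induct) auto

lemma dfinite_imp_minimal_order:
  assumes "dfinite T_fps"
  shows "\<exists>n. minimal_order n"
proof -
  obtain r p where nz: "\<exists>i\<le>r. p i \<noteq> 0"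
    and eq: "(\<Sum>i\<le>r. fps_of_poly (p i) * (fps_deriv ^^ i) T_fps) = 0"
    using assms by (auto simp: dfinite_def)
  \<comment> \<open>The leading coefficients of the given equation may vanish; k is its true order,
    so that \<open>p k\<close> can be inverted.\<close>
  define k where "k = Max {i. i \<le> r \<and> p i \<noteq> 0}"
  have fin: "finite {i. i \<le> r \<and> p i \<noteq> 0}" by simp
  have k: "k \<le> r" "p k \<noteq> 0" using Max_in[OF fin] nz unfolding k_def by auto
  have above: "p i = 0" if "k < i" "i \<le> r" for i
    using Max_ge[OF fin, of i] that by (fold k_def) force
  have "(\<Sum>i\<le>r. fps_of_poly (p i) * (fps_deriv ^^ i) T_fps) =
      (\<Sum>i\<le>k. fps_of_poly (p i) * (fps_deriv ^^ i) T_fps)"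
    using k above by (intro sum.mono_neutral_right) auto
  then have "fps_to_fls (\<Sum>i\<le>k. fps_of_poly (p i) * (fps_deriv ^^ i) T_fps) = 0"
    using eq by simp
  then have "(\<Sum>i\<le>k. fls_of_poly (p i) * jet (Suc i)) = 0"
    by (simp add: jet_def fls_times_fps_to_fls fps_to_fls_sum del: sum.atMost_Suc)
  then have "fls_of_poly (p k) * jet (Suc k) = - (\<Sum>i<k. fls_of_poly (p i) * jet (Suc i))"
    by (simp add: lessThan_Suc_atMost[symmetric] eq_neg_iff_add_eq_0 add.commute)
  moreover have nzp: "fls_of_poly (p k) \<noteq> 0" using k(2) fps_of_poly_eq_iff[of "p k" 0] by simp
  ultimately have "jet (Suc k) = (\<Sum>i<k. (- fls_of_poly (p i) / fls_of_poly (p k)) * jet (Suc i))"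
    by (simp add: field_simps sum_negf sum_divide_distrib[symmetric])
  also have "\<dots> \<in> lin_span rational jet (Suc k)"
  proof (intro lin_span_sum lin_span_mult lin_span_base is_subring_rational)
    fix i
    show "- fls_of_poly (p i) / fls_of_poly (p k) \<in> rational"
      using is_subringD(3,6)[OF is_subring_rational] fls_of_poly_rational rational_inverse
      by (simp add: divide_inverse)
  qed simp
  finally show ?thesis
    unfolding minimal_order_def using exists_least_iff[of "\<lambda>n. jet n \<in> lin_span rational jet n"] by blast
qed

lemma minimal_order_pos: "minimal_order n \<Longrightarrow> 0 < n"
  by (cases n) (auto simp: minimal_order_def lin_span_def)

text \<open>The jets and their pullbacks have equal spans at every length, so a first dependence
  among the pullbacks would be one among the jets.\<close>

lemma pjet_independent:
  assumes "minimal_order n" "k < n"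
  shows "pjet k \<notin> lin_span rational pjet k"
proof
  have R: "is_subring rational" by (rule is_subring_rational)
  assume k: "pjet k \<in> lin_span rational pjet k"
  have "pjet i \<in> lin_span rational pjet k" if "i < Suc k" for i
    using that k lin_span_base[OF R, of i k pjet] by (cases "i = k") auto
  then have "lin_span rational pjet (Suc k) \<subseteq> lin_span rational pjet k"
    by (rule lin_span_subset[OF R])
  then have "jet k \<in> lin_span rational jet k"
    using lin_span_base[OF R, of k "Suc k" jet] span_jet_eq_span_pjet_rational by auto
  then show False using assms by (auto simp: minimal_order_def)
qed

lemma pjet_coeffs_unique:
  assumes "minimal_order n" "\<And>i. c i \<in> rational" "\<And>i. d i \<in> rational"
    "(\<Sum>i<n. c i * pjet i) = (\<Sum>i<n. d i * pjet i)"
  shows "\<forall>i<n. c i = d i"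
  by (rule lin_span_unique[OF is_subring_rational rational_inverse pjet_independent[OF assms(1)]
        assms(2-4)])

lemma lin_span_Suc:
  assumes "is_subring A" "u n \<in> lin_span A u n"
  shows "lin_span A u (Suc n) = lin_span A u n"
proof
  show "lin_span A u (Suc n) \<subseteq> lin_span A u n"
    using assms(2) lin_span_base[OF assms(1), of _ n u]
    by (intro lin_span_subset assms(1)) (auto simp: less_Suc_eq)
qed (rule lin_span_mono[OF assms(1)], simp)

section \<open>Transport of ordinary points along B\<close>

lemma pullback_ordinary:
  assumes "ordinary n (Bfun y)" "1 + y\<^sup>2 \<noteq> 0"
  shows "pjet n \<in> lin_span (regular_at y) pjet n"
proof -
  obtain c where c: "\<And>i. c i \<in> regular_at (Bfun y)" "jet n = (\<Sum>i<n. c i * jet i)"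
    using assms(1) unfolding ordinary_def by (metis lin_spanE)
  have "pjet n = (\<Sum>i<n. pullback (c i) * pjet i)"
    by (simp add: pjet_def c(2) pullback_sum pullback_hom)
  then show ?thesis
    using lin_spanI[of "\<lambda>i. pullback (c i)"] regular_at_pullback[OF assms(2) c(1)] by metis
qed

lemma ordinary_preimage:
  assumes "ordinary n (Bfun y)" "y \<notin> exceptional"
  shows "ordinary n y"
proof -
  have R: "is_subring (regular_at y)" by (rule is_subring_regular_at)
  have "pjet n \<in> lin_span (regular_at y) pjet n"
    using assms by (intro pullback_ordinary) (auto dest: not_exceptionalD)
  then have "lin_span (regular_at y) pjet (Suc n) = lin_span (regular_at y) pjet n"
    by (rule lin_span_Suc[OF R])
  then show ?thesis
    using lin_span_base[OF R, of n "Suc n" jet] span_jet_eq_span_pjet[OF assms(2)]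
    by (simp add: ordinary_def)
qed

text \<open>There are two relations for \<open>pjet n\<close>: one with coefficients regular at y,
  and the pullback of the relation for \<open>jet n\<close>. Independence makes them equal, so the
  pulled back coefficients are regular at y and the original ones at B(y).\<close>

lemma ordinary_image:
  assumes n: "minimal_order n" and y: "ordinary n y" "y \<notin> exceptional"
  shows "ordinary n (Bfun y)"
proof -
  have R: "is_subring (regular_at y)" by (rule is_subring_regular_at)
  have sq: "1 + y\<^sup>2 \<noteq> 0" using not_exceptionalD[OF y(2)] by simp
  have "lin_span (regular_at y) jet (Suc n) = lin_span (regular_at y) jet n"
    using y(1) unfolding ordinary_def by (rule lin_span_Suc[OF R])
  then have "pjet n \<in> lin_span (regular_at y) pjet n"
    using lin_span_base[OF R, of n "Suc n" pjet] span_jet_eq_span_pjet[OF y(2)] by simp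
  then obtain e where e: "\<And>i. e i \<in> regular_at y" "pjet n = (\<Sum>i<n. e i * pjet i)"
    by (metis lin_spanE)
  obtain c where c: "\<And>i. c i \<in> rational" "jet n = (\<Sum>i<n. c i * jet i)"
    using n unfolding minimal_order_def by (metis lin_spanE)
  have pc: "pullback (c i) \<in> rational" for i by (rule pullback_rational[OF c(1)])
  have "pjet n = (\<Sum>i<n. pullback (c i) * pjet i)"
    by (simp add: pjet_def c(2) pullback_sum pullback_hom)
  then have "(\<Sum>i<n. pullback (c i) * pjet i) = (\<Sum>i<n. e i * pjet i)" by (simp only: e(2))
  moreover have "e i \<in> rational" for i using e(1) regular_at_subset_rational by blast
  ultimately have eq: "\<forall>i<n. pullback (c i) = e i" by (intro pjet_coeffs_unique[OF n pc])
  \<comment> \<open>Regularity is known only for coefficients below n; the others are reset to 0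
    because \<open>lin_span\<close> constrains all indices.\<close>
  define c' where "c' i = (if i < n then c i else 0)" for i
  have "c' i \<in> regular_at (Bfun y)" for i
    using regular_at_of_pullback[OF sq c(1)[of i]] eq e(1)[of i]
    by (auto simp: c'_def is_subringD(1)[OF is_subring_regular_at])
  moreover have "jet n = (\<Sum>i<n. c' i * jet i)" by (simp add: c(2) c'_def)
  ultimately show ?thesis unfolding ordinary_def using lin_spanI by metis
qed

lemma finite_not_ordinary:
  assumes "minimal_order n"
  shows "finite {y. \<not> ordinary n y}"
proof -
  obtain c where c: "\<And>i. c i \<in> rational" "jet n = (\<Sum>i<n. c i * jet i)"
    using assms unfolding minimal_order_def by (metis lin_spanE)
  have "ordinary n y" if "\<And>i. i < n \<Longrightarrow> c i \<in> regular_at y" for y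
  proof -
    have "(\<Sum>i<n. c i * jet i) \<in> lin_span (regular_at y) jet n"
      using that by (intro lin_span_sum lin_span_mult lin_span_base is_subring_regular_at) auto
    then show ?thesis by (simp add: ordinary_def c(2))
  qed
  then have "{y. \<not> ordinary n y} \<subseteq> (\<Union>i<n. {y. c i \<notin> regular_at y})" by auto
  then show ?thesis using finite_not_regular_at[OF c(1)] by (elim finite_subset) auto
qed

section \<open>Orbits\<close>

lemma Bfun_eq_iff:
  assumes "1 + x\<^sup>2 \<noteq> 0" "1 + z\<^sup>2 \<noteq> 0"
  shows "Bfun x = Bfun z \<longleftrightarrow> x = z \<or> x * z = 1"
proof -
  have "Bfun x = Bfun z \<longleftrightarrow> x * (1 + z\<^sup>2) = z * (1 + x\<^sup>2)"
    using assms by (simp add: Bfun_def frac_eq_eq)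
  also have "\<dots> \<longleftrightarrow> (x - z) * (1 - x * z) = 0"
    by (simp add: algebra_simps power2_eq_square)
  also have "\<dots> \<longleftrightarrow> x = z \<or> x * z = 1" by auto
  finally show ?thesis .
qed

text \<open>Division by zero makes \<open>Bfun (\<plusminus>\<i>) = 0\<close>, hence the preimages below avoid \<open>\<plusminus>\<i>\<close>.\<close>

lemma Bfun_nonzero_imp: "Bfun z \<noteq> 0 \<Longrightarrow> z \<noteq> 0 \<and> 1 + z\<^sup>2 \<noteq> 0"
  by (auto simp: Bfun_def)

lemma ex_Bfun_preimage:
  assumes "p \<noteq> 0"
  shows "\<exists>z. Bfun z = p"
proof -
  \<comment> \<open>B(z) = p amounts to p z^2 - z + p = 0, and a root with 1 + z^2 = 0 would give z
    = 0.\<close>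
  have "\<exists>z. poly [:p, -1, p:] z = 0"
    using assms by (intro fundamental_theorem_of_algebra_alt) auto
  then obtain z where z: "p * (1 + z\<^sup>2) = z" by (auto simp: algebra_simps power2_eq_square)
  have "1 + z\<^sup>2 \<noteq> 0" using z by (metis add.right_neutral mult_zero_right power_zero_numeral zero_neq_one)
  then have "Bfun z = p" using z by (simp add: Bfun_def divide_eq_eq)
  then show ?thesis ..
qed

section \<open>Infinite backward orbits\<close>

definition backward_orbit :: "complex \<Rightarrow> (nat \<Rightarrow> complex) \<Rightarrow> bool" where
  "backward_orbit p z \<longleftrightarrow> z 0 = p \<and> (\<forall>j. z j \<noteq> 0 \<and> Bfun (z (Suc j)) = z j)"

lemma ex_backward_orbit:
  assumes "p \<noteq> 0"
  shows "\<exists>z. backward_orbit p z"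
proof -
  have "\<exists>z. (z 0 \<noteq> 0 \<and> z 0 = p) \<and> (\<forall>j. (z (Suc j) \<noteq> 0) \<and> Bfun (z (Suc j)) = z j)"
  proof -
    have "\<exists>z. \<forall>j. (z j \<noteq> 0 \<and> (j = 0 \<longrightarrow> z j = p)) \<and> Bfun (z (Suc j)) = z j"
    proof (rule dependent_nat_choice)
      show "\<exists>x. x \<noteq> 0 \<and> (0 = 0 \<longrightarrow> x = p)" using assms by blast
      show "\<exists>y. (y \<noteq> 0 \<and> (Suc n = 0 \<longrightarrow> y = p)) \<and> Bfun y = x"
        if "x \<noteq> 0 \<and> (n = 0 \<longrightarrow> x = p)" for x n
        using ex_Bfun_preimage[of x] Bfun_nonzero_imp that by auto
    qed
    then show ?thesis by metis
  qed
  then show ?thesis unfolding backward_orbit_def by (metis not0_implies_Suc)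
qed

text \<open>From 2 |x| \<le> 1 + x^2 it follows that B maps the real line into [-1/2, 1/2]. A real p
  outside this interval is thus never reached from a real point.\<close>

lemma funpow_Bfun_real:
  "\<exists>t. \<bar>t\<bar> \<le> 1 / 2 \<and> (Bfun ^^ Suc k) (of_real x) = of_real t"
proof (induction k)
  have step: "\<exists>t. \<bar>t\<bar> \<le> 1 / 2 \<and> Bfun (of_real x) = of_real t" for x :: real
  proof (intro exI conjI)
    show "Bfun (of_real x) = of_real (x / (1 + x\<^sup>2))" by (simp add: Bfun_def)
    have "0 \<le> (\<bar>x\<bar> - 1)\<^sup>2" by simp
    then have "2 * \<bar>x\<bar> \<le> 1 + x\<^sup>2" by (simp add: power2_diff)
    moreover have "0 < 1 + x\<^sup>2" by (simp add: add_pos_nonneg)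
    ultimately show "\<bar>x / (1 + x\<^sup>2)\<bar> \<le> 1 / 2" by (simp add: abs_divide field_simps)
  qed
  {
    case 0
    show ?case using step by simp
  next
    case (Suc k)
    then show ?case using step by fastforce
  }
qed

context
  fixes p :: real and z :: "nat \<Rightarrow> complex"
  assumes orbit: "backward_orbit (of_real p) z" and p: "\<bar>p\<bar> > 1 / 2"
begin

lemma backward_orbit_funpow: "(Bfun ^^ k) (z (j + k)) = z j"
  using orbit by (induction k) (auto simp: backward_orbit_def funpow_swap1)

lemma backward_orbit_not_funpow_real: "(Bfun ^^ Suc k) (of_real x) \<noteq> of_real p"
  using funpow_Bfun_real[of k x] p by (metis linorder_not_le of_real_eq_iff)

text \<open>A repetition would make p periodic under B, hence an iterated image of the real point p
  itself.\<close>

lemma backward_orbit_inj: "inj z"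
proof (rule linorder_inj_onI')
  fix j k :: nat assume "j < k"
  then obtain d where d: "k = Suc d + j" by (metis add.commute add_Suc_right less_imp_Suc_add)
  show "z j \<noteq> z k"
  proof
    assume "z j = z k"
    have "of_real p = (Bfun ^^ k) (z (0 + k))"
      using backward_orbit_funpow[of k 0] orbit by (simp add: backward_orbit_def)
    also have "\<dots> = (Bfun ^^ Suc d) ((Bfun ^^ j) (z (0 + k)))"
      by (simp only: d funpow_add o_apply)
    also have "(Bfun ^^ j) (z (0 + k)) = of_real p"
      using backward_orbit_funpow[of j 0] orbit by (simp add: \<open>z j = z k\<close>[symmetric] backward_orbit_def)
    finally show False using backward_orbit_not_funpow_real by metis
  qed
qed

text \<open>The points 0, \<i> and -\<i> are sent to 0 by \<open>Bfun\<close>, which the orbit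
  avoids, while 1 and -1 are real and cannot reach p.\<close>

lemma backward_orbit_not_exceptional: "z (Suc j) \<notin> exceptional"
proof
  assume e: "z (Suc j) \<in> exceptional"
  have "Bfun (z (Suc j)) \<noteq> 0" using orbit by (simp add: backward_orbit_def)
  then have "z (Suc j) = 1 \<or> z (Suc j) = -1"
    using e by (auto simp: exceptional_def Bfun_def)
  then obtain x where "z (Suc j) = of_real x" by (metis of_real_1 of_real_minus)
  then have "(Bfun ^^ Suc j) (of_real x) = of_real p"
    using backward_orbit_funpow[of "Suc j" 0] orbit by (simp add: backward_orbit_def)
  then show False using backward_orbit_not_funpow_real by metis
qed

end

section \<open>Analytic behaviour of the series and its poles\<close>

definition Tterm :: "nat \<Rightarrow> complex \<Rightarrow> complex" where
  "Tterm n z = (\<Prod>j\<le>n. Bj j z / (1 + Bj j z))"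

lemma Tfun_eq: "Tfun z = 1 + (\<Sum>n. Tterm n z)"
  by (simp add: Tfun_def Tterm_def)

lemma Tterm_0: "Tterm 0 z = z / (1 + z)"
  by (simp add: Tterm_def Bj_def)

lemma Tterm_Suc: "Tterm (Suc n) z = z / (1 + z) * Tterm n (Bfun z)"
  unfolding Tterm_def prod.atMost_Suc_shift by (simp add: Bj_def funpow_swap1)

lemma Tfun_functional:
  assumes "summable (\<lambda>n. Tterm n (Bfun z))"
  shows "summable (\<lambda>n. Tterm n z)" "Tfun z = 1 + z / (1 + z) * Tfun (Bfun z)"
proof -
  have s: "summable (\<lambda>n. Tterm (Suc n) z)"
    unfolding Tterm_Suc by (rule summable_mult[OF assms])
  then show s': "summable (\<lambda>n. Tterm n z)" by (subst (asm) summable_Suc_iff)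
  have "(\<Sum>n. Tterm n z) = Tterm 0 z + (\<Sum>n. Tterm (Suc n) z)"
    using suminf_split_head[OF s'] by simp
  also have "(\<Sum>n. Tterm (Suc n) z) = z / (1 + z) * (\<Sum>n. Tterm n (Bfun z))"
    unfolding Tterm_Suc by (rule suminf_mult[OF assms])
  finally show "Tfun z = 1 + z / (1 + z) * Tfun (Bfun z)"
    by (simp add: Tfun_eq Tterm_0 algebra_simps)
qed

text \<open>In the coordinate \<open>w = 1 / z\<close> the map \<open>B\<close> reads \<open>w \<mapsto> w + 1 / w\<close> and the factor
  \<open>z / (1 + z)\<close> becomes \<open>1 / (1 + w)\<close>.\<close>

lemma Re_inverse_Bfun:
  assumes "Re (1 / z) \<le> - r" "0 < r"
  shows "Re (1 / Bfun z) \<le> - r" "1 + z\<^sup>2 \<noteq> 0"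
proof -
  have z: "z \<noteq> 0" using assms by auto
  show nz: "1 + z\<^sup>2 \<noteq> 0"
  proof
    assume "1 + z\<^sup>2 = 0"
    then have "z * z = -1" by (simp add: power2_eq_square eq_neg_iff_add_eq_0 add.commute)
    then have "1 / z = - z" using z by (simp add: field_simps)
    moreover have "Re (z * z) = -1" "Im (z * z) = 0" using \<open>z * z = -1\<close> by auto
    then have "Re z = 0" by (auto simp: not_sum_power2_lt_zero) (smt (verit) mult_nonneg_nonneg zero_le_square)
    ultimately show False using assms by simp
  qed
  \<comment> \<open>The real parts of z and 1 / z have the same sign, so adding z moves 1 / z no
    further to the right.\<close>
  have "1 / Bfun z = 1 / z + z" using z nz by (simp add: Bfun_def field_simps power2_eq_square)
  moreover have "Re z \<le> 0"
  proof -
    have "Re (1 / z) \<le> 0" using assms by linarith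
    then show ?thesis by (simp add: Re_divide divide_le_0_iff) (smt (verit) sum_power2_gt_zero_iff)
  qed
  ultimately show "Re (1 / Bfun z) \<le> - r" using assms by simp
qed

text \<open>For w = 1 / z in the half-plane, |1 + w| is at least s, so each factor is at most 1 / s;
  the half-plane is stable under B.\<close>

lemma norm_Tterm_le:
  assumes "Re (1 / z) \<le> - (1 + s)" "0 < s"
  shows "norm (Tterm n z) \<le> (1 / s) ^ Suc n"
  using assms(1)
proof (induction n arbitrary: z)
  have first: "norm (z / (1 + z)) \<le> 1 / s" if "Re (1 / z) \<le> - (1 + s)" for z
  proof -
    have z: "z \<noteq> 0" using that assms(2) by auto
    then have eq: "z / (1 + z) = 1 / (1 + 1 / z)"
      by (cases "1 + z = 0") (auto simp: field_simps add_eq_0_iff)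
    have "s \<le> \<bar>Re (1 + 1 / z)\<bar>" using that by (simp only: plus_complex.sel one_complex.sel)
    also have "\<dots> \<le> norm (1 + 1 / z)" by (rule abs_Re_le_cmod)
    finally show ?thesis unfolding eq using assms(2) by (simp add: norm_divide frac_le)
  qed
  {
    case 0
    then show ?case using first by (simp add: Tterm_0)
  next
    case (Suc n)
    have "Re (1 / Bfun z) \<le> - (1 + s)" using Re_inverse_Bfun(1)[OF Suc.prems] assms(2) by simp
    then have "norm (Tterm n (Bfun z)) \<le> (1 / s) ^ Suc n" by (rule Suc.IH)
    then show ?case unfolding Tterm_Suc norm_mult power_Suc[of _ "Suc n"]
      using first[OF Suc.prems] assms(2) by (intro mult_mono) auto
  }
qed

lemma
  assumes "Re (1 / z) \<le> - (1 + s)" "1 < s"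
  shows summable_Tterm: "summable (\<lambda>n. Tterm n z)"
    and norm_Tfun_le: "norm (Tfun z) \<le> s / (s - 1)"
proof -
  have n: "norm (1 / s) < 1" using assms(2) by simp
  have le: "norm (Tterm n z) \<le> (1 / s) ^ Suc n" for n
    using norm_Tterm_le assms by simp
  have g: "summable (\<lambda>n. (1 / s) ^ Suc n)"
    using summable_geometric[OF n] by (subst summable_Suc_iff)
  show "summable (\<lambda>n. Tterm n z)"
    by (rule summable_comparison_test'[OF g]) (rule le)
  have "norm (\<Sum>n. Tterm n z) \<le> (\<Sum>n. (1 / s) ^ Suc n)"
    by (rule norm_suminf_le[OF le g])
  also have "\<dots> = 1 / s * (1 / (1 - 1 / s))"
    by (simp only: power_Suc suminf_mult[OF summable_geometric[OF n]] suminf_geometric[OF n])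
  also have "\<dots> = s / (s - 1) - 1" using assms(2) by (simp add: field_simps)
  finally show "norm (Tfun z) \<le> s / (s - 1)"
    unfolding Tfun_eq using norm_triangle_ineq[of 1 "\<Sum>n. Tterm n z"] by simp
qed

text \<open>The geometric bound makes the series converge uniformly, by the Weierstrass
  M-test.\<close>

lemma continuous_on_Tfun:
  assumes "1 < s"
  shows "continuous_on {z. Re (1 / z) \<le> - (1 + s)} Tfun"
proof -
  define D where "D = {z. Re (1 / z) \<le> - (1 + s)}"
  have nz: "z \<noteq> 0 \<and> 1 + z \<noteq> 0 \<and> 1 + z\<^sup>2 \<noteq> 0 \<and> Bfun z \<in> D" if "z \<in> D" for z
  proof -
    have "z \<noteq> 0" "z \<noteq> -1" using that assms by (auto simp: D_def)
    then show ?thesis using that Re_inverse_Bfun[of z "1 + s"] assms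
      by (auto simp: D_def add_eq_0_iff)
  qed
  have B: "continuous_on D Bfun"
    unfolding Bfun_def by (intro continuous_intros) (use nz in auto)
  have "continuous_on D (Tterm n)" for n
  proof (induction n)
    case 0
    show ?case unfolding Tterm_0 by (intro continuous_intros) (use nz in auto)
  next
    case (Suc n)
    have "continuous_on D (\<lambda>z. Tterm n (Bfun z))"
      by (rule continuous_on_compose2[OF Suc B]) (use nz in auto)
    then show ?case unfolding Tterm_Suc by (intro continuous_intros) (use nz in auto)
  qed
  then have c: "continuous_on D (\<lambda>z. \<Sum>n<N. Tterm n z)" for N by (intro continuous_intros)
  have "uniform_limit D (\<lambda>N z. \<Sum>n<N. Tterm n z) (\<lambda>z. \<Sum>n. Tterm n z) sequentially"
  proof (rule Weierstrass_m_test)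
    show "norm (Tterm n z) \<le> (1 / s) ^ Suc n" if "z \<in> D" for n z
      using norm_Tterm_le that assms by (simp add: D_def)
    show "summable (\<lambda>n. (1 / s) ^ Suc n)"
      using summable_geometric[of "1 / s"] assms by (subst summable_Suc_iff) simp
  qed
  then have "continuous_on D (\<lambda>z. \<Sum>n. Tterm n z)"
    by (rule uniform_limit_theorem[rotated]) (auto simp: c)
  then show ?thesis unfolding D_def[symmetric] Tfun_eq by (intro continuous_intros)
qed

text \<open>Summability nearby is included because \<open>suminf\<close> has a value even for a
  divergent series, whereas the functional equation is derived from convergence.\<close>

definition regular_point :: "complex \<Rightarrow> bool" where
  "regular_point p \<longleftrightarrow> isCont Tfun p \<and> (\<forall>\<^sub>F z in nhds p. summable (\<lambda>n. Tterm n z))"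

lemma isCont_Bfun: "1 + p\<^sup>2 \<noteq> 0 \<Longrightarrow> isCont Bfun p"
  unfolding Bfun_def by (intro continuous_intros)

lemma eventually_nhds_isCont:
  assumes "isCont f p" "eventually P (nhds (f p))"
  shows "\<forall>\<^sub>F x in nhds p. P (f x)"
proof -
  have "filterlim f (nhds (f p)) (nhds p)"
    using assms(1) by (simp add: continuous_at tendsto_at_iff_tendsto_nhds)
  then show ?thesis using assms(2) by (simp add: filterlim_iff)
qed

lemma regular_point_preimage:
  assumes "regular_point (Bfun p)" "1 + p \<noteq> 0" "1 + p\<^sup>2 \<noteq> 0"
  shows "regular_point p"
proof -
  have ev: "\<forall>\<^sub>F z in nhds p. summable (\<lambda>n. Tterm n (Bfun z))"
    using assms(1) by (intro eventually_nhds_isCont[OF isCont_Bfun[OF assms(3)]]) (simp add: regular_point_def)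
  have "isCont (\<lambda>z. 1 + z / (1 + z) * Tfun (Bfun z)) p"
    using assms by (intro continuous_intros isCont_o2[of p Bfun Tfun] isCont_Bfun) (auto simp: regular_point_def)
  moreover have "\<forall>\<^sub>F z in nhds p. Tfun z = 1 + z / (1 + z) * Tfun (Bfun z)"
    using ev by eventually_elim (rule Tfun_functional)
  ultimately have "isCont Tfun p" using isCont_cong by fast
  moreover have "\<forall>\<^sub>F z in nhds p. summable (\<lambda>n. Tterm n z)"
    using ev by eventually_elim (rule Tfun_functional)
  ultimately show ?thesis by (simp add: regular_point_def)
qed

section \<open>The series at -1/2\<close>

lemma Bfun_minus_half: "Bfun (-(1/2)) = -(2/5)" "Bfun (-(2/5)) = -(10/29)" "Bfun (-(10/29)) = -(290/941)"
  by (simp_all add: Bfun_def power2_eq_square)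

text \<open>At -1/2 the coordinate is w = -2, on the boundary where the geometric ratio is 1. One
  step of B leads to w = -5/2, inside the half-plane for s = 5/4, and the functional equation
  carries regularity back.\<close>

lemma regular_point_minus_half: "regular_point (-(1/2))"
proof -
  define U where "U = {z::complex. z \<noteq> 0 \<and> Re (1 / z) < -(9/4)}"
  have U: "open U" "-(2/5) \<in> U"
  proof -
    have "open {z \<in> - {0}. (\<lambda>z::complex. Re (1 / z)) z \<in> {..< -(9/4)}}"
      by (rule continuous_open_preimage[unfolded vimage_def Int_def mem_Collect_eq])
         (auto intro!: continuous_intros)
    moreover have "{z \<in> - {0}. (\<lambda>z::complex. Re (1 / z)) z \<in> {..< -(9/4)}} = U"
      by (auto simp: U_def)
    ultimately show "open U" by simp
    show "-(2/5) \<in> U" by (simp add: U_def)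
  qed
  have "continuous_on U Tfun"
    by (rule continuous_on_subset[OF continuous_on_Tfun[of "5/4"]]) (auto simp: U_def)
  then have "isCont Tfun (-(2/5))" using U by (simp add: continuous_on_eq_continuous_at)
  moreover have "\<forall>\<^sub>F z in nhds (-(2/5)). summable (\<lambda>n. Tterm n z)"
    using eventually_nhds_in_open[OF U] 
    by eventually_elim (rule summable_Tterm[of _ "5/4"], auto simp: U_def)
  ultimately have "regular_point (-(2/5))" by (simp add: regular_point_def)
  then show ?thesis
    by (rule regular_point_preimage[of "-(1/2)", unfolded Bfun_minus_half]) (simp_all add: power2_eq_square)
qed

text \<open>Three uses of the functional equation express the value at -1/2 through v at -290/941. A
  zero would force v = 19/10, above the bound 56/31 on the norm of v.\<close>

lemma Tfun_minus_half_nonzero: "Tfun (-(1/2)) \<noteq> 0"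
proof
  define v where "v = Tfun (-(290/941))"
  have s: "summable (\<lambda>n. Tterm n (-(290/941)))"
    \<comment> \<open>Here s = 56/25, and 1 + s = 81/25 is just below 941/290; then s / (s - 1) =
      56/31.\<close>
    by (rule summable_Tterm[of _ "28/25 * 2"]) auto
  have "norm v \<le> (28/25 * 2) / (28/25 * 2 - 1)"
    unfolding v_def by (rule norm_Tfun_le) auto
  then have v: "norm v \<le> 56 / 31" by simp
  note f3 = Tfun_functional[of "-(10/29)", unfolded Bfun_minus_half, OF s]
  note f2 = Tfun_functional[of "-(2/5)", unfolded Bfun_minus_half, OF f3(1)]
  note f1 = Tfun_functional[of "-(1/2)", unfolded Bfun_minus_half, OF f2(1)]
  assume "Tfun (-(1/2)) = 0"
  then have "v = 19 / 10" using f1(2) f2(2) f3(2) by (simp add: v_def field_simps)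
  then have "norm v = 19 / 10" by (simp only: norm_divide norm_numeral)
  then show False using v by simp
qed

section \<open>The pole at -1 and its preimages\<close>

definition summable_pole :: "complex \<Rightarrow> bool" where
  "summable_pole p \<longleftrightarrow> is_pole Tfun p \<and> (\<forall>\<^sub>F z in at p. summable (\<lambda>n. Tterm n z))"

lemma summable_pole_minus_one: "summable_pole (-1)"
proof -
  have B: "Bfun (-1) = -(1/2)" by (simp add: Bfun_def)
  have c: "isCont Bfun (-1)" by (rule isCont_Bfun) simp
  have ev: "\<forall>\<^sub>F z in nhds (-1). summable (\<lambda>n. Tterm n (Bfun z))"
    using regular_point_minus_half by (intro eventually_nhds_isCont[OF c]) (simp add: regular_point_def B)
  then have ev': "\<forall>\<^sub>F z in at (-1). summable (\<lambda>n. Tterm n (Bfun z))"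
    by (simp add: eventually_nhds_conv_at)
  have "is_pole (\<lambda>z. (z * Tfun (Bfun z)) / (1 + z)) (-1)"
  proof (rule is_pole_divide)
    show "isCont (\<lambda>z. z * Tfun (Bfun z)) (-1)"
      using regular_point_minus_half
      by (intro continuous_intros isCont_o2[of _ Bfun Tfun] c) (simp add: regular_point_def B)
    show "filterlim (\<lambda>z. 1 + z) (at 0) (at (-1::complex))"
      by (auto simp: filterlim_at eventually_at add_eq_0_iff intro!: tendsto_eq_intros exI[of _ 1])
    show "- 1 * Tfun (Bfun (- 1)) \<noteq> 0" using Tfun_minus_half_nonzero by (simp add: B)
  qed
  then have "is_pole (\<lambda>z. (z * Tfun (Bfun z)) / (1 + z) + 1) (-1)"
    by (subst (asm) is_pole_plus_const_iff)
  moreover have "\<forall>\<^sub>F z in at (-1). (z * Tfun (Bfun z)) / (1 + z) + 1 = Tfun z"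
    using ev' by eventually_elim (simp add: Tfun_functional(2))
  ultimately have "is_pole Tfun (-1)" by (rule is_pole_transform) simp
  moreover have "\<forall>\<^sub>F z in at (-1). summable (\<lambda>n. Tterm n z)"
    using ev' by eventually_elim (rule Tfun_functional)
  ultimately show ?thesis by (simp add: summable_pole_def)
qed

lemma summable_pole_preimage:
  assumes "summable_pole (Bfun p)" "p \<notin> exceptional"
  shows "summable_pole p"
proof -
  note nz = not_exceptionalD[OF assms(2)]
  have lim: "Bfun \<midarrow>p\<rightarrow> Bfun p" using isCont_Bfun[OF nz(4)] by (simp add: isCont_def)
  have "((\<lambda>x. 1 + x\<^sup>2) \<longlongrightarrow> 1 + p\<^sup>2) (at p)" by (intro tendsto_intros)
  then have "\<forall>\<^sub>F x in at p. 1 + x\<^sup>2 \<noteq> 0" using nz(4) by (rule tendsto_imp_eventually_ne)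
  \<comment> \<open>The fibre of B through p consists of p and 1 / p; off these points B(x) avoids
    the pole B(p).\<close>
  moreover have "\<forall>\<^sub>F x in at p. x \<noteq> p" "\<forall>\<^sub>F x in at p. x \<noteq> 1 / p"
    by (rule eventually_neq_at_within)+
  ultimately have ne: "\<forall>\<^sub>F x in at p. Bfun x \<noteq> Bfun p"
    by eventually_elim (use nz in \<open>auto simp: Bfun_eq_iff field_simps\<close>)
  then have B: "filterlim Bfun (at (Bfun p)) (at p)" using lim by (simp add: filterlim_at)
  then have ev: "\<forall>\<^sub>F z in at p. summable (\<lambda>n. Tterm n (Bfun z))"
    using assms(1) by (auto simp: summable_pole_def filterlim_iff)
  have "is_pole (\<lambda>z. Tfun (Bfun z)) p"
    using assms(1) by (intro is_pole_compose[OF _ lim ne]) (simp add: summable_pole_def)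
  then have "is_pole (\<lambda>z. z / (1 + z) * Tfun (Bfun z)) p"
    using nz by (intro is_pole_mult_analytic_nonzero1) (auto intro!: analytic_intros)
  then have "is_pole (\<lambda>z. z / (1 + z) * Tfun (Bfun z) + 1) p"
    by (subst (asm) is_pole_plus_const_iff)
  moreover have "\<forall>\<^sub>F z in at p. z / (1 + z) * Tfun (Bfun z) + 1 = Tfun z"
    using ev by eventually_elim (simp add: Tfun_functional(2))
  ultimately have "is_pole Tfun p" by (rule is_pole_transform) simp
  moreover have "\<forall>\<^sub>F z in at p. summable (\<lambda>n. Tterm n z)"
    using ev by eventually_elim (rule Tfun_functional)
  ultimately show ?thesis by (simp add: summable_pole_def)
qed

lemma infinite_poles: "infinite {z. is_pole Tfun z}"
proof -
  obtain z where "backward_orbit (-1) z" using ex_backward_orbit[of "-1"] by auto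
  then have z: "backward_orbit (of_real (-1)) z" by simp
  have "summable_pole (z j)" for j
  proof (induction j)
    case 0
    show ?case using z summable_pole_minus_one by (simp add: backward_orbit_def)
  next
    case (Suc j)
    show ?case
      using z Suc.IH
      by (intro summable_pole_preimage[OF _ backward_orbit_not_exceptional[OF z]])
         (simp_all add: backward_orbit_def)
  qed
  then have "range z \<subseteq> {z. is_pole Tfun z}" by (auto simp: summable_pole_def)
  moreover have "infinite (range z)"
    using backward_orbit_inj[OF z] by (simp add: finite_image_iff)
  ultimately show ?thesis using infinite_super by blast
qed

section \<open>Ordinary points on the real axis\<close>

text \<open>The backward orbit of p is infinite and only finitely many points fail to be ordinary,
  so some orbit point is ordinary; this property is pushed forward to p.\<close>

lemma ordinary_real:
  assumes n: "minimal_order n" and p: "\<bar>p\<bar> > 1 / 2"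
  shows "ordinary n (of_real p)"
proof -
  have "of_real p \<noteq> (0 :: complex)" using p by auto
  then obtain z where z: "backward_orbit (of_real p) z" using ex_backward_orbit by blast
  have "infinite (range z)"
    using backward_orbit_inj[OF z p] by (simp add: finite_image_iff)
  then have "\<not> range z \<subseteq> {y. \<not> ordinary n y}"
    using finite_not_ordinary[OF n] finite_subset by blast
  then obtain N where N: "ordinary n (z N)" by auto
  \<comment> \<open>Truncated subtraction stays at 0 once k passes N, so the case k = N is the point
    p.\<close>
  have "ordinary n (z (N - k))" for k
  proof (induction k)
    case (Suc k)
    show ?case
    proof (cases "k < N")
      case True
      then have "N - k = Suc (N - Suc k)" by simp
      then show ?thesis
        using ordinary_image[OF n _ backward_orbit_not_exceptional[OF z p, of "N - Suc k"]] Suc.IH z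
        by (simp add: backward_orbit_def)
    qed (use Suc.IH in simp)
  qed (use N in simp)
  from this[of N] show ?thesis using z by (simp add: backward_orbit_def)
qed

lemma real_not_exceptional: "x \<noteq> 0 \<Longrightarrow> \<bar>x\<bar> \<noteq> 1 \<Longrightarrow> complex_of_real x \<notin> exceptional"
  by (auto simp: exceptional_def complex_eq_iff)

text \<open>The backward orbit of \<open>-1/2\<close> is the exceptional point \<open>-1\<close> followed by that of \<open>-1\<close>, so
  \<open>-1/2\<close> is reached from \<open>-2\<close>, via their common image \<open>-2/5\<close>.\<close>

lemma ordinary_minus_half:
  assumes n: "minimal_order n"
  shows "ordinary n (-(1/2))"
proof -
  have "ordinary n (of_real (-2))" by (rule ordinary_real[OF n]) simp
  then have "ordinary n (Bfun (of_real (-2)))"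
    by (rule ordinary_image[OF n]) (rule real_not_exceptional, simp_all)
  also have "Bfun (of_real (-2)) = Bfun (of_real (-(1/2)))" by (simp add: Bfun_def power2_eq_square)
  finally have "ordinary n (of_real (-(1/2)))"
    by (rule ordinary_preimage) (rule real_not_exceptional, simp_all)
  then show ?thesis by simp
qed

section \<open>A minimal equation of positive order\<close>

lemma lin_span_rational_clear:
  assumes "f \<in> lin_span rational u n"
  shows "\<exists>m. (fls_X - fls_const y) ^ m * f \<in> lin_span (regular_at y) u n"
proof -
  note R = is_subring_regular_at[of y]
  have pi: "fls_X - fls_const y \<in> regular_at y"
    by (rule regular_atI[OF rat_val_diff[OF rat_val_X rat_val_const]])
  obtain c where c: "\<And>i. c i \<in> rational" "f = (\<Sum>i<n. c i * u i)" using assms by (metis lin_spanE)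
  obtain m where m: "\<And>i. (fls_X - fls_const y) ^ m i * c i \<in> regular_at y"
    using rational_power_mult_regular[OF c(1)] by metis
  \<comment> \<open>The sum is a convenient common upper bound for the exponents.\<close>
  define M where "M = (\<Sum>i<n. m i)"
  have "(fls_X - fls_const y) ^ M * c i \<in> regular_at y" if "i < n" for i
  proof -
    have "m i \<le> M" unfolding M_def using that by (intro member_le_sum) auto
    then have "(fls_X - fls_const y) ^ M * c i
        = (fls_X - fls_const y) ^ (M - m i) * ((fls_X - fls_const y) ^ m i * c i)"
      by (simp add: power_add[symmetric] flip: mult.assoc)
    then show ?thesis using is_subringD(6)[OF R is_subring_power[OF R pi] m] by metis
  qed
  then have "(\<Sum>i<n. ((fls_X - fls_const y) ^ M * c i) * u i) \<in> lin_span (regular_at y) u n"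
    by (intro lin_span_sum[OF R] lin_span_mult[OF R] lin_span_base[OF R]) auto
  moreover have "(fls_X - fls_const y) ^ M * f = (\<Sum>i<n. ((fls_X - fls_const y) ^ M * c i) * u i)"
    by (simp add: c(2) sum_distrib_left mult.assoc)
  ultimately show ?thesis by metis
qed

text \<open>Two finitely generated modules over the local ring at \<open>y\<close> that are stable under
  differentiation and span the same space over the rational functions coincide: with
  \<open>\<pi> = x - y\<close>, differentiating \<open>\<pi>\<^bsup>m+1\<^esup> f \<in> N\<close> gives \<open>(m + 1) \<pi>\<^bsup>m\<^esup> f \<in> N\<close>.\<close>

lemma deriv_stable_lin_span_subset:
  assumes stable_u: "\<And>f. f \<in> lin_span (regular_at y) u n \<Longrightarrow> fls_deriv f \<in> lin_span (regular_at y) u n"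
    and stable_v: "\<And>f. f \<in> lin_span (regular_at y) v k \<Longrightarrow> fls_deriv f \<in> lin_span (regular_at y) v k"
    and uv: "\<And>i. i < n \<Longrightarrow> u i \<in> lin_span rational v k"
  shows "lin_span (regular_at y) u n \<subseteq> lin_span (regular_at y) v k"
proof -
  note R = is_subring_regular_at[of y]
  define \<pi> where "\<pi> = fls_X - fls_const y"
  define N where "N = lin_span (regular_at y) v k"
  have pi: "\<pi> \<in> regular_at y" unfolding \<pi>_def
    by (rule regular_atI[OF rat_val_diff[OF rat_val_X rat_val_const]])
  have "\<forall>i. \<exists>m. i < n \<longrightarrow> \<pi> ^ m * u i \<in> N"
    using lin_span_rational_clear[OF uv] unfolding \<pi>_def N_def by blast
  then obtain m where m: "\<And>i. i < n \<Longrightarrow> \<pi> ^ m i * u i \<in> N" by metis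
  define M where "M = (\<Sum>i<n. m i)"
  have gen: "\<pi> ^ M * u i \<in> N" if "i < n" for i
  proof -
    have "m i \<le> M" unfolding M_def using that by (intro member_le_sum) auto
    then have "\<pi> ^ M * u i = \<pi> ^ (M - m i) * (\<pi> ^ m i * u i)"
      by (simp add: power_add[symmetric] flip: mult.assoc)
    then show ?thesis
      by (simp only: N_def lin_span_mult[OF R is_subring_power[OF R pi] m[OF that, unfolded N_def]])
  qed
  have base: "\<pi> ^ M * f \<in> N" if f: "f \<in> lin_span (regular_at y) u n" for f
  proof -
    obtain c where c: "\<And>i. c i \<in> regular_at y" "f = (\<Sum>i<n. c i * u i)"
      using f by (metis lin_spanE)
    have "(\<Sum>i<n. c i * (\<pi> ^ M * u i)) \<in> N"
      unfolding N_def by (rule lin_span_sum[OF R], rule lin_span_mult[OF R c(1)])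
        (simp add: gen[unfolded N_def])
    then show ?thesis by (simp add: c(2) sum_distrib_left mult.left_commute)
  qed
  have "\<pi> ^ (M - j) * f \<in> N" if "f \<in> lin_span (regular_at y) u n" for j f
    using that
  proof (induction j arbitrary: f)
    case 0
    then show ?case using base by simp
  next
    case (Suc j)
    show ?case
    proof (cases "j < M")
      case True
      then obtain l where l: "M - j = Suc l" "M - Suc j = l" by (metis Suc_diff_Suc)
      \<comment> \<open>The induction hypothesis also applies to the derivative of f, by stability
        of the first module; subtracting isolates the term with the lower power of \<pi>.\<close>
      have "\<pi> ^ Suc l * f \<in> N" "\<pi> ^ Suc l * fls_deriv f \<in> N"
        using Suc.IH[OF Suc.prems] Suc.IH[OF stable_u[OF Suc.prems]] by (simp_all only: l)
      then have "fls_deriv (\<pi> ^ Suc l * f) - \<pi> ^ Suc l * fls_deriv f \<in> N"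
        unfolding N_def by (intro lin_span_diff[OF R] stable_v)
      moreover have "fls_deriv \<pi> = 1" by (simp add: \<pi>_def)
      then have "fls_deriv (\<pi> ^ Suc l * f) - \<pi> ^ Suc l * fls_deriv f = fls_const (of_nat (Suc l)) * (\<pi> ^ l * f)"
        by (simp add: fls_deriv_power fls_of_nat algebra_simps del: power_Suc of_nat_Suc)
      ultimately have "fls_const (1 / of_nat (Suc l)) * (fls_const (of_nat (Suc l)) * (\<pi> ^ l * f)) \<in> N"
        using lin_span_mult[OF R regular_atI[OF rat_val_const]] by (simp only: N_def)
      then have "\<pi> ^ l * f \<in> N"
        by (simp flip: mult.assoc del: of_nat_Suc)
      then show ?thesis by (simp only: l)
    qed (use Suc in simp)
  qed
  from this[of _ M] show ?thesis by (auto simp: N_def)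
qed

lemma minimal_order_not_ge_2:
  assumes n: "minimal_order n"
  shows "n < 2"
proof (rule ccontr)
  assume "\<not> n < 2"
  then have n2: "0 < n" "1 < n" by auto
  note R = is_subring_regular_at[of "-1"]
  have B: "fls_deriv Bfls \<in> regular_at (-1)"
    by (rule regular_atI[OF rat_val_deriv_Bfls]) simp
  have "ordinary n (of_real (-1))" by (rule ordinary_real[OF n]) simp
  then have j: "jet n \<in> lin_span (regular_at (-1)) jet n" by (simp add: ordinary_def)
  have "Bfun (-1) = -(1/2)" by (simp add: Bfun_def)
  then have p: "pjet n \<in> lin_span (regular_at (-1)) pjet n"
    using ordinary_minus_half[OF n] by (intro pullback_ordinary) simp_all
  have "lin_span (regular_at (-1)) jet n \<subseteq> lin_span (regular_at (-1)) pjet n"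
  proof (rule deriv_stable_lin_span_subset)
    show "fls_deriv f \<in> lin_span (regular_at (-1)) jet n" if "f \<in> lin_span (regular_at (-1)) jet n" for f
      using deriv_lin_span_jet[OF diff_subring_regular_at that] lin_span_Suc[where u = jet, OF R j] by simp
    show "fls_deriv f \<in> lin_span (regular_at (-1)) pjet n" if "f \<in> lin_span (regular_at (-1)) pjet n" for f
      using deriv_lin_span_pjet[OF diff_subring_regular_at B that] lin_span_Suc[where u = pjet, OF R p] by simp
    show "jet i \<in> lin_span rational pjet n" if "i < n" for i
      using lin_span_base[OF is_subring_rational that, of jet] span_jet_eq_span_pjet_rational by simp
  qed
  then have "jet 1 \<in> lin_span (regular_at (-1)) pjet n"
    using lin_span_base[OF R n2(2), of jet] by blast
  then obtain e where e: "\<And>i. e i \<in> regular_at (-1)" "jet 1 = (\<Sum>i<n. e i * pjet i)"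
    by (metis lin_spanE)
  define a :: "complex fls" where "a = fls_X / (1 + fls_X)"
  \<comment> \<open>These are the coordinates of T given by T = 1 + x / (1 + x) T o B; both
    generators are available because n is at least 2.\<close>
  define c where "c i = (if i = 0 then 1 else if i = 1 then a else 0)" for i :: nat
  have nz: "(1 + fls_X :: complex fls) \<noteq> 0"
    using rat_val_unique[OF rat_val_add[OF rat_val_1 rat_val_X, of 0]] rat_val_const[of 0 0] by force
  have "a \<in> rational"
    unfolding a_def divide_inverse
    by (intro is_subringD(6)[OF is_subring_rational] rational_inverse
        subsetD[OF regular_at_subset_rational, of _ 0] regular_atI[OF rat_val_X]
        regular_atI[OF rat_val_add[OF rat_val_1 rat_val_X]])
  then have c: "c i \<in> rational" for i
    using is_subringD(1,2)[OF is_subring_rational] by (simp add: c_def)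
  have "jet 1 = 1 + a * pjet 1" using nz jet_functional by (simp add: a_def field_simps)
  also have "\<dots> = (\<Sum>i\<in>{0, 1}. c i * pjet i)" by (simp add: c_def)
  also have "\<dots> = (\<Sum>i<n. c i * pjet i)"
    using n2 by (intro sum.mono_neutral_left) (auto simp: c_def)
  finally have "(\<Sum>i<n. c i * pjet i) = (\<Sum>i<n. e i * pjet i)" by (simp only: e(2))
  moreover have "e i \<in> rational" for i using e(1) regular_at_subset_rational by blast
  ultimately have "\<forall>i<n. c i = e i" by (intro pjet_coeffs_unique[OF n c])
  then have "a = e 1" using n2 by (auto simp: c_def)
  then have "a \<in> regular_at (-1)" using e(1) by simp
  then obtain v where "rat_val a (-1) v" by (auto simp: regular_at_def)
  \<comment> \<open>The product is x, whose value at -1 is -1, but regularity of \<open>a\<close>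
    would give the value 0.\<close>
  then have "rat_val (a * (1 + fls_X)) (-1) (v * (1 + -1))"
    by (intro rat_val_mult rat_val_add rat_val_1 rat_val_X)
  moreover have "a * (1 + fls_X) = fls_X" using nz by (simp add: a_def)
  ultimately show False using rat_val_unique[OF rat_val_X[of "-1"], of "v * (1 + -1)"] by simp
qed

section \<open>The rational case\<close>

lemma rat_val_functional:
  assumes "rat_val (jet 1) y a" "rat_val (jet 1) (Bfun y) b" "1 + y\<^sup>2 \<noteq> 0"
  shows "(1 + y) * (a - 1) = y * b"
proof -
  have "rat_val ((1 + fls_X) * (jet 1 - 1)) y ((1 + y) * (a - 1))"
    by (intro rat_val_mult rat_val_add rat_val_diff rat_val_1 rat_val_X assms(1))
  moreover have "rat_val (fls_X * pjet 1) y (y * b)"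
    unfolding pjet_def by (intro rat_val_mult rat_val_X rat_val_pullback assms)
  ultimately show ?thesis unfolding jet_functional by (rule rat_val_unique)
qed

text \<open>B is odd, so the orbit is the negative of that of 1/2 under t / (1 + t^2). The latter
  decreases to a fixed point, which can only be 0.\<close>

lemma orbit_minus_half:
  obtains s :: "nat \<Rightarrow> real" where
    "\<And>k. (Bfun ^^ k) (-(1/2)) = - of_real (s k)" "\<And>k. 0 < s k" "\<And>k. s k \<le> 1 / 2" "s \<longlonglongrightarrow> 0"
proof
  define f where "f t = t / (1 + t\<^sup>2)" for t :: real
  define s where "s k = (f ^^ k) (1 / 2)" for k
  have pos: "0 < 1 + t\<^sup>2" for t :: real by (simp add: add_pos_nonneg)
  have s_Suc: "s (Suc k) = s k / (1 + (s k)\<^sup>2)" for k by (simp add: s_def f_def)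
  show gt: "0 < s k" for k
  proof (induction k)
    case (Suc k)
    then show ?case unfolding s_Suc using pos by simp
  qed (simp add: s_def)
  have le: "s (Suc k) \<le> s k" for k
    unfolding s_Suc using gt[of k] pos[of "s k"] by (simp add: divide_le_eq)
  then have dec: "decseq s" by (rule decseq_SucI)
  show "s k \<le> 1 / 2" for k using decseqD[OF dec, of 0 k] by (simp add: s_def)
  show "(Bfun ^^ k) (-(1/2)) = - of_real (s k)" for k
  proof (induction k)
    case (Suc k)
    have "(Bfun ^^ Suc k) (-(1/2)) = Bfun (- of_real (s k))" using Suc by simp
    also have "\<dots> = - of_real (s (Suc k))" by (simp add: Bfun_def s_Suc)
    finally show ?case .
  qed (simp add: s_def)
  obtain L where L: "s \<longlonglongrightarrow> L" using decseq_convergent[OF dec, of 0] gt less_imp_le by metis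
  have "(\<lambda>k. s k / (1 + (s k)\<^sup>2)) \<longlonglongrightarrow> L / (1 + L\<^sup>2)"
    using pos[of L] by (intro tendsto_intros L) simp
  then have "(\<lambda>k. s (Suc k)) \<longlonglongrightarrow> L / (1 + L\<^sup>2)" by (simp add: s_Suc)
  then have "L = L / (1 + L\<^sup>2)" by (rule LIMSEQ_unique[OF LIMSEQ_Suc[OF L]])
  then have "L * (1 + L\<^sup>2) = L" using pos[of L] by (simp only: eq_divide_eq)
  then have "L = 0" by (simp add: distrib_left)
  then show "s \<longlonglongrightarrow> 0" using L by simp
qed

text \<open>A rational T would be regular at -1 and hence vanish at B(-1) = -1/2. Its values along
  the orbit of -1/2 converge, so the remainder of the unrolled functional equation tends to 0, which
  identifies the value at -1/2 with the nonzero sum of the series.\<close>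

lemma minimal_order_not_1: "\<not> minimal_order 1"
proof
  assume n: "minimal_order 1"
  \<comment> \<open>For n = 1 the span is the local ring itself, since
    \<open>jet 0 = 1\<close>.\<close>
  have T_regular: "jet 1 \<in> regular_at y" if y: "ordinary 1 y" for y
  proof -
    obtain c where "\<And>i. c i \<in> regular_at y" "jet 1 = (\<Sum>i<1. c i * jet i)"
      using y unfolding ordinary_def by (metis lin_spanE)
    then show ?thesis by simp
  qed
  obtain s where s: "\<And>k. (Bfun ^^ k) (-(1/2)) = - of_real (s k)" "\<And>k. 0 < s k"
    "\<And>k. s k \<le> 1 / 2" "s \<longlonglongrightarrow> 0"
    using orbit_minus_half by blast
  define x where "x k = (Bfun ^^ k) (-(1/2))" for k
  have x_exc: "x k \<notin> exceptional" for k
    using real_not_exceptional[of "- s k"] s(2,3)[of k] by (simp add: x_def s(1))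
  have xS: "x (Suc k) = Bfun (x k)" for k by (simp add: x_def)
  have "ordinary 1 (x k)" for k
  proof (induction k)
    case (Suc k)
    show ?case unfolding xS by (rule ordinary_image[OF n Suc x_exc])
  qed (use ordinary_minus_half[OF n] in \<open>simp add: x_def\<close>)
  then have "\<exists>v. rat_val (jet 1) (x k) v" for k using T_regular[of "x k"] by (simp add: regular_at_def)
  then obtain v where v: "\<And>k. rat_val (jet 1) (x k) (v k)" by metis
  have v_rec: "v k = 1 + x k / (1 + x k) * v (Suc k)" for k
    using rat_val_functional[OF v[of k] v[of "Suc k", unfolded xS]] not_exceptionalD[OF x_exc[of k]]
    by (simp add: field_simps)

  have "ordinary 1 (of_real (-1))" by (rule ordinary_real[OF n]) simp
  then obtain a where a: "rat_val (jet 1) (-1) a" using T_regular by (force simp: regular_at_def)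
  have "Bfun (-1) = x 0" by (simp add: x_def Bfun_def)
  \<comment> \<open>At -1 the side of the functional equation with the factor 1 + y vanishes, which
    leaves 0 = - v 0.\<close>
  then have "v 0 = 0" using rat_val_functional[OF a, of "v 0"] v[of 0] by simp

  have "jet 1 \<in> lin_span rational jet 1" using n by (simp add: minimal_order_def)
  then have "jet 1 \<in> rational" by (auto simp: lin_span_def)
  then obtain P Q where PQ: "jet 1 * fls_of_poly Q = fls_of_poly P"
    "\<And>y. poly Q y = 0 \<Longrightarrow> poly P y \<noteq> 0"
    using rational_reduced by metis
  have "T_fps * fps_of_poly Q = fps_of_poly P"
    using PQ(1) by (simp add: jet_def flip: fls_times_fps_to_fls)
  then have "fps_nth T_fps 0 * coeff Q 0 = coeff P 0"
    by (metis fps_mult_nth_0 fps_of_poly_nth)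
  \<comment> \<open>T is a power series, so Q(0) = 0 would force P(0) = 0, against lowest
    terms.\<close>
  then have Q0: "poly Q 0 \<noteq> 0" using PQ(2)[of 0] by (auto simp: poly_0_coeff_0)
  have "v k * poly Q (x k) = poly P (x k)" for k
    by (rule rat_val_unique[OF rat_val_mult[OF v rat_val_poly[of Q], of k, unfolded PQ(1)] rat_val_poly])
  then have v_eq: "v k = poly P (x k) / poly Q (x k)" for k
    using PQ(2)[of "x k"] by (metis mult_zero_right nonzero_eq_divide_eq)
  have "x \<longlonglongrightarrow> - of_real 0" unfolding x_def s(1) by (intro tendsto_intros s(4))
  then have v_lim: "v \<longlonglongrightarrow> poly P 0 / poly Q 0"
    unfolding v_eq using Q0 by (auto intro!: tendsto_intros)

  \<comment> \<open>The functional equation unrolled N + 1 times; \<open>Tterm N\<close> is already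
    counted in the sum, whence the - 1 in the remainder.\<close>
  have partial: "v k = 1 + (\<Sum>n<Suc N. Tterm n (x k)) + Tterm N (x k) * (v (k + Suc N) - 1)" for k N
  proof (induction N arbitrary: k)
    case 0
    show ?case using v_rec[of k] by (simp add: Tterm_0 right_diff_distrib del: times_divide_eq_left)
  next
    case (Suc N)
    have "v k = 1 + x k / (1 + x k) * (1 + (\<Sum>n<Suc N. Tterm n (x (Suc k))) +
        Tterm N (x (Suc k)) * (v (Suc k + Suc N) - 1))"
      using v_rec[of k] Suc[of "Suc k"] by metis
    also have "\<dots> = 1 + (Tterm 0 (x k) + (\<Sum>n<Suc N. Tterm (Suc n) (x k))) +
        Tterm (Suc N) (x k) * (v (Suc k + Suc N) - 1)"
      unfolding Tterm_Suc Tterm_0 xS sum_distrib_left[symmetric] by (simp only: algebra_simps mult_1_left mult_1_right)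
    also have "Tterm 0 (x k) + (\<Sum>n<Suc N. Tterm (Suc n) (x k)) = (\<Sum>n<Suc (Suc N). Tterm n (x k))"
      by (rule sum.lessThan_Suc_shift[symmetric])
    finally show ?case by simp
  qed
  have sm: "summable (\<lambda>n. Tterm n (x 0))"
    using regular_point_minus_half by (auto simp: regular_point_def x_def dest: eventually_nhds_x_imp_x)
  have "(\<lambda>N. Tterm N (x 0) * (v (0 + Suc N) - 1)) \<longlonglongrightarrow> 0 * (poly P 0 / poly Q 0 - 1)"
    using LIMSEQ_Suc[OF v_lim] by (intro tendsto_intros summable_LIMSEQ_zero[OF sm]) simp
  moreover have "(\<lambda>N. \<Sum>n<Suc N. Tterm n (x 0)) \<longlonglongrightarrow> (\<Sum>n. Tterm n (x 0))"
    by (rule LIMSEQ_Suc[OF summable_LIMSEQ[OF sm]])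
  ultimately have "(\<lambda>N. 1 + (\<Sum>n<Suc N. Tterm n (x 0)) + Tterm N (x 0) * (v (0 + Suc N) - 1))
      \<longlonglongrightarrow> 1 + (\<Sum>n. Tterm n (x 0)) + 0 * (poly P 0 / poly Q 0 - 1)"
    using tendsto_add[OF tendsto_add[OF tendsto_const]] by blast
  then have "(\<lambda>N. v 0) \<longlonglongrightarrow> 1 + (\<Sum>n. Tterm n (x 0)) + 0 * (poly P 0 / poly Q 0 - 1)"
    by (simp only: partial[of 0, symmetric])
  then have "v 0 = Tfun (-(1/2))"
    using LIMSEQ_unique[OF tendsto_const] by (force simp: Tfun_eq x_def)
  then show False using \<open>v 0 = 0\<close> Tfun_minus_half_nonzero by simp
qed

theorem theorem2p5:
  shows "infinite {z. is_pole Tfun z} \<and> \<not> dfinite T_fps"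
proof
  show "infinite {z. is_pole Tfun z}" by (rule infinite_poles)
  show "\<not> dfinite T_fps"
  proof
    assume "dfinite T_fps"
    then obtain n where n: "minimal_order n" using dfinite_imp_minimal_order by blast
    then have "n = 1" using minimal_order_pos minimal_order_not_ge_2 by fastforce
    then show False using n minimal_order_not_1 by simp
  qed
qed

end
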